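(* Consider the general setting in which the set $A$ of alternatives need not equal the set $C$ of agents, and let $\mathcal A$ be any $\rho$-approximation algorithm for (cardinal) $\ell$-centrum, where $\rho=O(1)$. The mechanism SampleMech-Gen defined in the context, run with $\mathcal A$ and parameter $\delta\in(0,1)$, has $O\bigl(k\log\ell\,\log(1/\delta)\bigr)$ per-agent query complexity, and achieves $O(1)$-distortion for the $\ell$-centrum problem with probability at least $1-\delta$; that is, with probability at least $1-\delta$ its output $T\subseteq A$ satisfies $|T|\le k$ and $\mathrm{Top}_\ell(d(C,T))\le O(1)\cdot\mathrm{OPT}_\ell$.
   Context: Setting. $C$ is a finite set of $n$ agents and $A$ a finite set of alternatives. There is an unknown distance function $d:C\times A\to\mathbb R_{\ge0}$ with $d(i,a)\le d(i,b)+d(j,b)+d(j,a)$ for all $i,j\in C$, $a,b\in A$. The preference profile $\sigma=(\succeq_i)_{i\in C}$ consists of total orders on $A$ consistent with $d$: $a\succeq_i b$ implies $d(i,a)\le d(i,b)$. $\mathrm{top}(i)$ is $i$'s most preferred alternative. For $S\subseteq A$ nonempty, $d(i,S)=\min_{a\in S}d(i,a)$ and $d(C,S)=(d(i,S))_{i\in C}$. $\mathrm{Top}_\ell(v)$ is the sum of the $\ell$ largest entries of $v$; $z^+=\max\{z,0\}$. $\mathrm{OPT}_\ell=\min\{\mathrm{Top}_\ell(d(C,S)):S\subseteq A,|S|\le k\}$. Mechanisms know $\sigma$ but not $d$; a value query to agent $i\in C$ about $a\in A$ returns $d(i,a)$ (alternatives cannot be queried). Per-agent query complexity is the maximum number of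 queries made to any single agent; logarithmic factors in query bounds are read as at least 1. A $\rho$-approximation algorithm $\mathcal A$ for $\ell$-centrum, given a client set $C$, a facility set $P$ and the distances $d$ on $C\times P$, returns at most $k$ points of $P$ whose $\mathrm{Top}_\ell$-cost is at most $\rho$ times the minimum over such sets. Subroutine modified $k$-center. Start with the empty center-set. In each of $k$ iterations $t=1,\dots,k$, let $s_t\in C$ be an agent farthest from the currently open center-set (arbitrary for $t=1$; otherwise found with one value query per agent, for its distance to its favourite open center), and open a center at $\mathrm{top}(s_t)$. Return the set of opened centers. Subroutine ADSample-$\mathrm{Top}_\ell$-Gen (parameter $t_\ell$). $S_0=\emptyset$. For $i=1,\dots,\lceil38(k+\sqrt k)\rceil$: sample an agent $s_i\in C$ with probability proportional to $(d(s_i,S_{i-1})-3t_\ell)^+$ (uniformly for $i=1$), using one value query per agent to find the distances to $S_{i-1}$; set $S_i=S_{i-1}\cup\{\mathrm{top}(s_i)\}$. Return the final set. Mechanism SampleMech-Gen (input: $\sigma$, $\mathcal A$; parameter $\delta$; fixed constant $\varepsilon>0$). 1. Let $S_0$ be the output of the modified $k$-center subroutine and $B_1=\max_{j\in C}d(j,S_0)$. Set $\mathcal T=\{\ell\cdot B_1(1+\varepsilon)^{-r}:r=0,\dots,\log_{1+\varepsilon}(3\ell^2/\varepsilon)\}$ and $\mathcal S=\emptyset$. 2. For each $t_\ell\in\mathcal T$, repeat $\log(1/\delta)$ times: let $S$ be the output of ADSample-$\mathrm{Top}_\ell$-Gen with parameter $t_\ell$; add $S$ to $\mathcal S$ and compute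 $d(C,S)$ using one query per agent. 3. Let $\bar S=\arg\min_{S\in\mathcal S}\mathrm{Top}_\ell(d(C,S))$. Query $d(j,a)$ for all $j\in C$, $a\in\bar S$. Return $\mathcal A((C,\bar S),d)$, i.e. run $\mathcal A$ with client set $C$ and facility set $\bar S$. *)

theory Defs
  imports "HOL-Probability.Probability" "HOL-Library.Multiset" "HOL-Library.Monad_Syntax"
begin

definition distance_fun :: "'c set \<Rightarrow> 'a set \<Rightarrow> ('c \<Rightarrow> 'a \<Rightarrow> real) \<Rightarrow> bool" where
  "distance_fun C A d \<longleftrightarrow>
     (\<forall>i\<in>C. \<forall>a\<in>A. 0 \<le> d i a) \<and>
     (\<forall>i\<in>C. \<forall>j\<in>C. \<forall>a\<in>A. \<forall>b\<in>A. d i a \<le> d i b + d j b + d j a)"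

text \<open>The pair \<open>(a, b) \<in> \<sigma> i\<close> means that agent \<open>i\<close> weakly prefers \<open>a\<close> to \<open>b\<close>; thus the
  most preferred alternative is the \<^emph>\<open>least\<close> element in the library's reading of the order.\<close>

definition preference_profile :: "'c set \<Rightarrow> 'a set \<Rightarrow> ('c \<Rightarrow> 'a rel) \<Rightarrow> bool" where
  "preference_profile C A \<sigma> \<longleftrightarrow> (\<forall>i\<in>C. linear_order_on A (\<sigma> i))"

definition consistent :: "'c set \<Rightarrow> 'a set \<Rightarrow> ('c \<Rightarrow> 'a rel) \<Rightarrow> ('c \<Rightarrow> 'a \<Rightarrow> real) \<Rightarrow> bool" where
  "consistent C A \<sigma> d \<longleftrightarrow> (\<forall>i\<in>C. \<forall>a\<in>A. \<forall>b\<in>A. (a, b) \<in> \<sigma> i \<longrightarrow> d i a \<le> d i b)"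

definition favourite :: "'a rel \<Rightarrow> 'a set \<Rightarrow> 'a" where
  "favourite r S = (THE a. a \<in> S \<and> (\<forall>b\<in>S. (a, b) \<in> r))"

definition set_dist :: "('c \<Rightarrow> 'a \<Rightarrow> real) \<Rightarrow> 'a set \<Rightarrow> 'c \<Rightarrow> real" where
  "set_dist d S i = Min (d i ` S)"

definition Top :: "nat \<Rightarrow> 'c set \<Rightarrow> ('c \<Rightarrow> real) \<Rightarrow> real" where
  "Top l C v = sum_list (take l (rev (sorted_list_of_multiset (image_mset v (mset_set C)))))"

definition OPT :: "nat \<Rightarrow> nat \<Rightarrow> 'c set \<Rightarrow> 'a set \<Rightarrow> ('c \<Rightarrow> 'a \<Rightarrow> real) \<Rightarrow> real" where
  "OPT k l C A d = Min {Top l C (set_dist d S) | S. S \<subseteq> A \<and> S \<noteq> {} \<and> card S \<le> k}"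

type_synonym ('c, 'a) centrum_alg = "'c set \<Rightarrow> 'a set \<Rightarrow> ('c \<Rightarrow> 'a \<Rightarrow> real) \<Rightarrow> 'a set"

definition centrum_approximation :: "real \<Rightarrow> nat \<Rightarrow> nat \<Rightarrow> ('c, 'a) centrum_alg \<Rightarrow> bool" where
  "centrum_approximation \<rho> k l alg \<longleftrightarrow>
     (\<forall>C P d. finite C \<longrightarrow> l \<le> card C \<longrightarrow> finite P \<longrightarrow> P \<noteq> {} \<longrightarrow> distance_fun C P d \<longrightarrow>
        alg C P d \<subseteq> P \<and> alg C P d \<noteq> {} \<and> card (alg C P d) \<le> k \<and>
        Top l C (set_dist d (alg C P d)) \<le> \<rho> * OPT k l C P d)"

text \<open>A mechanism is an adaptive decision tree. It has no access to the distance function other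
  than through the answers to its \<open>Query\<close> nodes; \<open>Query i a f\<close> asks agent \<open>i\<close> about
  alternative \<open>a\<close> and continues with \<open>f\<close> applied to the answer.\<close>

datatype ('c, 'a, 'x) mechanism =
    Return 'x
  | Query 'c 'a "real \<Rightarrow> ('c, 'a, 'x) mechanism"
  | Sample "'c pmf" "'c \<Rightarrow> ('c, 'a, 'x) mechanism"

primrec mechanism_bind ::
  "('c, 'a, 'x) mechanism \<Rightarrow> ('x \<Rightarrow> ('c, 'a, 'y) mechanism) \<Rightarrow> ('c, 'a, 'y) mechanism" where
  "mechanism_bind (Return x) g = g x"
| "mechanism_bind (Query i a f) g = Query i a (\<lambda>r. mechanism_bind (f r) g)"
| "mechanism_bind (Sample p f) g = Sample p (\<lambda>s. mechanism_bind (f s) g)"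

adhoc_overloading Monad_Syntax.bind \<rightleftharpoons> mechanism_bind

text \<open>Joint distribution of the output and of the number of queries put to each agent when the
  queries are answered according to \<open>d\<close>. Repeated queries are counted each time.\<close>

primrec run ::
  "('c \<Rightarrow> 'a \<Rightarrow> real) \<Rightarrow> ('c, 'a, 'x) mechanism \<Rightarrow> ('x \<times> ('c \<Rightarrow> nat)) pmf" where
  "run d (Return x) = return_pmf (x, \<lambda>_. 0)"
| "run d (Query i a f) = map_pmf (\<lambda>(x, q). (x, q(i := Suc (q i)))) (run d (f (d i a)))"
| "run d (Sample p f) = bind_pmf p (\<lambda>s. run d (f s))"

text \<open>An arbitrary enumeration of a finite set; it only fixes the order of simultaneous queries.\<close>

definition listing :: "'b set \<Rightarrow> 'b list" where
  "listing X = (SOME xs. distinct xs \<and> set xs = X)"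

primrec query_table :: "('c \<times> 'a) list \<Rightarrow> ('c, 'a, 'c \<Rightarrow> 'a \<Rightarrow> real) mechanism" where
  "query_table [] = Return (\<lambda>_ _. 0)"
| "query_table (p # ps) = Query (fst p) (snd p) (\<lambda>r.
     do { D \<leftarrow> query_table ps;
          Return (D(fst p := (D (fst p))(snd p := r))) })"

text \<open>The distances of all agents to a nonempty set \<open>S\<close>, with one query per agent: each agent is
  asked about its favourite element of \<open>S\<close>, which is known from the preference profile.\<close>

definition query_set_dist ::
  "'c set \<Rightarrow> ('c \<Rightarrow> 'a rel) \<Rightarrow> 'a set \<Rightarrow> ('c, 'a, 'c \<Rightarrow> real) mechanism" where
  "query_set_dist C \<sigma> S =
     do { D \<leftarrow> query_table (map (\<lambda>i. (i, favourite (\<sigma> i) S)) (listing C));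
          Return (\<lambda>i. D i (favourite (\<sigma> i) S)) }"

text \<open>Arbitrary choices (in particular tie-breaking) are made by a given selection function.\<close>

definition selector :: "('b set \<Rightarrow> 'b) \<Rightarrow> bool" where
  "selector sel \<longleftrightarrow> (\<forall>X. X \<noteq> {} \<longrightarrow> sel X \<in> X)"

definition farthest_agent ::
  "('c set \<Rightarrow> 'c) \<Rightarrow> 'c set \<Rightarrow> ('c \<Rightarrow> 'a rel) \<Rightarrow> 'a set \<Rightarrow> ('c, 'a, 'c) mechanism" where
  "farthest_agent sel C \<sigma> S =
     (if S = {} then Return (sel C)
      else do { v \<leftarrow> query_set_dist C \<sigma> S;
                Return (sel {i \<in> C. \<forall>j\<in>C. v j \<le> v i}) })"

primrec k_center_loop ::
  "('c set \<Rightarrow> 'c) \<Rightarrow> 'c set \<Rightarrow> 'a set \<Rightarrow> ('c \<Rightarrow> 'a rel) \<Rightarrow> nat \<Rightarrow> 'a set \<Rightarrow>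
   ('c, 'a, 'a set) mechanism" where
  "k_center_loop sel C A \<sigma> 0 S = Return S"
| "k_center_loop sel C A \<sigma> (Suc n) S =
     do { s \<leftarrow> farthest_agent sel C \<sigma> S;
          k_center_loop sel C A \<sigma> n (insert (favourite (\<sigma> s) A) S) }"

definition modified_k_center ::
  "('c set \<Rightarrow> 'c) \<Rightarrow> nat \<Rightarrow> 'c set \<Rightarrow> 'a set \<Rightarrow> ('c \<Rightarrow> 'a rel) \<Rightarrow> ('c, 'a, 'a set) mechanism" where
  "modified_k_center sel k C A \<sigma> = k_center_loop sel C A \<sigma> k {}"

text \<open>Distribution on \<open>C\<close> proportional to nonnegative weights. If all weights vanish,
  proportionality does not determine a distribution and the uniform one is used.\<close>

definition proportional_pmf :: "'c set \<Rightarrow> ('c \<Rightarrow> real) \<Rightarrow> 'c pmf" where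
  "proportional_pmf C w =
     (if (\<Sum>j\<in>C. w j) = 0 then pmf_of_set C
      else embed_pmf (\<lambda>i. if i \<in> C then w i / (\<Sum>j\<in>C. w j) else 0))"

definition adaptive_sample ::
  "'c set \<Rightarrow> ('c \<Rightarrow> 'a rel) \<Rightarrow> real \<Rightarrow> 'a set \<Rightarrow> ('c, 'a, 'c) mechanism" where
  "adaptive_sample C \<sigma> t S =
     (if S = {} then Sample (pmf_of_set C) Return
      else do { v \<leftarrow> query_set_dist C \<sigma> S;
                Sample (proportional_pmf C (\<lambda>i. max (v i - 3 * t) 0)) Return })"

primrec AD_sample_loop ::
  "'c set \<Rightarrow> 'a set \<Rightarrow> ('c \<Rightarrow> 'a rel) \<Rightarrow> real \<Rightarrow> nat \<Rightarrow> 'a set \<Rightarrow> ('c, 'a, 'a set) mechanism" where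
  "AD_sample_loop C A \<sigma> t 0 S = Return S"
| "AD_sample_loop C A \<sigma> t (Suc n) S =
     do { s \<leftarrow> adaptive_sample C \<sigma> t S;
          AD_sample_loop C A \<sigma> t n (insert (favourite (\<sigma> s) A) S) }"

definition AD_sample_Top_Gen ::
  "nat \<Rightarrow> 'c set \<Rightarrow> 'a set \<Rightarrow> ('c \<Rightarrow> 'a rel) \<Rightarrow> real \<Rightarrow> ('c, 'a, 'a set) mechanism" where
  "AD_sample_Top_Gen k C A \<sigma> t =
     AD_sample_loop C A \<sigma> t (nat \<lceil>38 * (real k + sqrt (real k))\<rceil>) {}"

text \<open>The upper end of the range of exponents is rounded up to a natural number; in particular
  the exponent \<open>0\<close> always occurs, even if \<open>\<epsilon> > 3 * l\<^sup>2\<close> makes the logarithm negative.\<close>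

definition threshold_guesses :: "real \<Rightarrow> nat \<Rightarrow> real \<Rightarrow> real set" where
  "threshold_guesses \<epsilon> l B =
     {real l * B * (1 + \<epsilon>) powr (- real r) | r. r \<le> nat \<lceil>log (1 + \<epsilon>) (3 * (real l)\<^sup>2 / \<epsilon>)\<rceil>}"

primrec sample_candidates ::
  "nat \<Rightarrow> nat \<Rightarrow> 'c set \<Rightarrow> 'a set \<Rightarrow> ('c \<Rightarrow> 'a rel) \<Rightarrow> real list \<Rightarrow>
   ('c, 'a, ('a set \<times> real) list) mechanism" where
  "sample_candidates k l C A \<sigma> [] = Return []"
| "sample_candidates k l C A \<sigma> (t # ts) =
     do { S \<leftarrow> AD_sample_Top_Gen k C A \<sigma> t;
          v \<leftarrow> query_set_dist C \<sigma> S;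
          cands \<leftarrow> sample_candidates k l C A \<sigma> ts;
          Return ((S, Top l C v) # cands) }"

text \<open>The logarithm in the number of repetitions is natural and rounded up. The algorithm
  \<open>alg\<close> receives the queried distances on \<open>C \<times> Sbar\<close> only.\<close>

definition SampleMech_Gen ::
  "('c set \<Rightarrow> 'c) \<Rightarrow> ('a set set \<Rightarrow> 'a set) \<Rightarrow> real \<Rightarrow> real \<Rightarrow> nat \<Rightarrow> nat \<Rightarrow> 'c set \<Rightarrow> 'a set \<Rightarrow>
   ('c \<Rightarrow> 'a rel) \<Rightarrow> ('c, 'a) centrum_alg \<Rightarrow> ('c, 'a, 'a set) mechanism" where
  "SampleMech_Gen sel sel' \<epsilon> \<delta> k l C A \<sigma> alg =
     do { S0 \<leftarrow> modified_k_center sel k C A \<sigma>;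
          v \<leftarrow> query_set_dist C \<sigma> S0;
          let B1 = Max (v ` C);
          cands \<leftarrow> sample_candidates k l C A \<sigma>
            (concat (map (replicate (nat \<lceil>ln (1 / \<delta>)\<rceil>))
              (sorted_list_of_set (threshold_guesses \<epsilon> l B1))));
          let Sbar = sel' {S. \<exists>c. (S, c) \<in> set cands \<and> (\<forall>(S', c') \<in> set cands. c \<le> c')};
          D \<leftarrow> query_table (List.product (listing C) (listing Sbar));
          Return (alg C Sbar D) }"

end

theory Submission
  imports Defs
begin

text \<open>
  Let \<open>u\<close> be the vector of distances to an optimal set of centers and \<open>t\<close> a threshold with
  \<open>OPT \<le> l * t\<close>. Fewer than \<open>l\<close> entries of \<open>u\<close> exceed \<open>t\<close>, so the
  \<^emph>\<open>heavy\<close> part of \<open>u\<close>, its entries above \<open>t\<close>, sums to at most \<open>OPT\<close>. Call an optimal cluster bad for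
  \<open>S\<close> if its total excess over \<open>3 * t\<close> is more than 13 times its heavy part. In a bad cluster at least
  two thirds of the excess is carried by agents whose heavy part is at most 6 times the cluster
  average, and opening the favourite of such an agent turns the cluster good. Hence, while the
  total excess is more than 52 times the heavy part of \<open>u\<close>, each sample reduces the number \<open>b\<close> of bad
  clusters with probability at least \<open>1 / 2\<close>, and the potential \<open>2 ^ b\<close> shows that \<open>n\<close> samples fail
  with probability at most \<open>2 ^ k * (3 / 4) ^ n\<close>. As the \<open>k\<close>-center cost is at most \<open>3 * OPT\<close>, some
  guess satisfies \<open>OPT \<le> l * t \<le> (1 + \<epsilon>) * OPT\<close>; then the sampled set costs at most
  \<open>3 * l * t + 52 * OPT\<close> with probability at least \<open>1 - exp (- 1)\<close> in each of the \<open>ln (1 / \<delta>)\<close>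
  repetitions. Running the approximation algorithm on it loses another constant factor.
\<close>

section \<open>Runs of mechanisms\<close>

definition result_pmf :: "('c \<Rightarrow> 'a \<Rightarrow> real) \<Rightarrow> ('c, 'a, 'x) mechanism \<Rightarrow> 'x pmf" where
  "result_pmf d m = map_pmf fst (run d m)"

text \<open>A Hoare-style judgement over the whole support of \<open>run\<close>: postcondition and
  per-agent budget hold for every outcome of the random choices. Bundling them lets one composition
  rule carry both correctness and query complexity.\<close>

definition ensures ::
  "('c \<Rightarrow> 'a \<Rightarrow> real) \<Rightarrow> 'c set \<Rightarrow> ('c, 'a, 'x) mechanism \<Rightarrow> ('x \<Rightarrow> bool) \<Rightarrow> nat \<Rightarrow> bool" where
  "ensures d I m P b \<longleftrightarrow> (\<forall>(x, q) \<in> set_pmf (run d m). P x \<and> (\<forall>i\<in>I. q i \<le> b))"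

lemma run_bind:
  "run d (mechanism_bind m g) =
     bind_pmf (run d m) (\<lambda>(x, q). map_pmf (\<lambda>(y, q'). (y, \<lambda>i. q i + q' i)) (run d (g x)))"
proof (induction m)
  case (Return x)
  show ?case by (simp add: bind_return_pmf map_pmf_idI case_prod_unfold)
next
  case (Query i a f)
  show ?case
    by (auto simp: Query map_bind_pmf bind_map_pmf case_prod_unfold pmf.map_comp o_def
        intro!: bind_pmf_cong pmf.map_cong0)
next
  case (Sample p f)
  show ?case by (simp add: Sample bind_assoc_pmf)
qed

lemma result_Return [simp]: "result_pmf d (Return x) = return_pmf x"
  by (simp add: result_pmf_def)

lemma result_Sample [simp]: "result_pmf d (Sample p f) = bind_pmf p (\<lambda>s. result_pmf d (f s))"
  by (simp add: result_pmf_def map_bind_pmf)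

lemma result_bind:
  "result_pmf d (mechanism_bind m g) = bind_pmf (result_pmf d m) (\<lambda>x. result_pmf d (g x))"
  by (simp add: result_pmf_def run_bind map_bind_pmf bind_map_pmf case_prod_unfold
      pmf.map_comp o_def)

lemma ensures_result: "ensures d I m P b \<Longrightarrow> x \<in> set_pmf (result_pmf d m) \<Longrightarrow> P x"
  by (auto simp: ensures_def result_pmf_def)

lemma ensures_Return: "P x \<Longrightarrow> ensures d I (Return x) P b"
  by (auto simp: ensures_def)

lemma ensures_Sample: "(\<And>s. s \<in> set_pmf p \<Longrightarrow> ensures d I (f s) P b) \<Longrightarrow> ensures d I (Sample p f) P b"
  by (auto simp: ensures_def)

text \<open>Budgets add up along a sequence, and the continuation is only analysed for outputs that
  satisfy the first postcondition. The slack \<open>c\<close> leaves the form of the total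
  free.\<close>

lemma ensures_bind:
  assumes "ensures d I m P a" and "\<And>x. P x \<Longrightarrow> ensures d I (g x) R b" and "a + b \<le> c"
  shows "ensures d I (mechanism_bind m g) R c"
proof -
  have "R y \<and> (\<forall>i\<in>I. q i + q' i \<le> c)"
    if "(x, q) \<in> set_pmf (run d m)" "(y, q') \<in> set_pmf (run d (g x))" for x y q q'
  proof -
    have "P x" "\<forall>i\<in>I. q i \<le> a" using that(1) assms(1) by (auto simp: ensures_def)
    moreover have "R y" "\<forall>i\<in>I. q' i \<le> b"
      using that(2) assms(2)[OF \<open>P x\<close>] by (auto simp: ensures_def)
    ultimately show ?thesis using assms(3) by (meson add_mono order_trans)
  qed
  then show ?thesis by (auto simp: ensures_def run_bind)
qed

lemma ensures_weaken:
  "ensures d I m P a \<Longrightarrow> (\<And>x. P x \<Longrightarrow> R x) \<Longrightarrow> a \<le> b \<Longrightarrow> ensures d I m R b"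
  by (fastforce simp: ensures_def)

lemma run_query_table:
  "run d (query_table ps) =
     return_pmf (\<lambda>i a. if (i, a) \<in> set ps then d i a else 0, \<lambda>i. length (filter (\<lambda>p. fst p = i) ps))"
proof (induction ps)
  case (Cons p ps)
  have "run d (query_table (p # ps)) = return_pmf
     ((\<lambda>i a. if (i, a) \<in> set ps then d i a else 0)(fst p :=
        ((\<lambda>i a. if (i, a) \<in> set ps then d i a else 0) (fst p))(snd p := d (fst p) (snd p))),
      (\<lambda>i. length (filter (\<lambda>p. fst p = i) ps))(fst p := Suc (length (filter (\<lambda>p'. fst p' = fst p) ps))))"
    by (simp add: run_bind Cons bind_return_pmf)
  also have "\<dots> = return_pmf (\<lambda>i a. if (i, a) \<in> set (p # ps) then d i a else 0,
      \<lambda>i. length (filter (\<lambda>p. fst p = i) (p # ps)))"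
    by (cases p) (auto simp: fun_eq_iff)
  finally show ?case .
qed simp

lemma ensures_query_table:
  assumes "\<And>i. i \<in> I \<Longrightarrow> length (filter (\<lambda>p. fst p = i) ps) \<le> b"
  shows "ensures d I (query_table ps) (\<lambda>D. D = (\<lambda>i a. if (i, a) \<in> set ps then d i a else 0)) b"
  using assms by (auto simp: ensures_def run_query_table)

lemma listing:
  assumes "finite X"
  shows "distinct (listing X)" "set (listing X) = X"
proof -
  have "\<exists>xs. distinct xs \<and> set xs = X" using finite_distinct_list[OF assms] by blast
  then have "distinct (listing X) \<and> set (listing X) = X" unfolding listing_def by (rule someI_ex)
  then show "distinct (listing X)" "set (listing X) = X" by auto
qed

lemma length_filter_eq_le_1: "distinct xs \<Longrightarrow> length (filter (\<lambda>x. x = i) xs) \<le> 1"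
  by (induction xs) (auto simp: filter_empty_conv)

lemma length_filter_product_le:
  "distinct xs \<Longrightarrow> length (filter (\<lambda>p. fst p = i) (List.product xs ys)) \<le> length ys"
proof (induction xs)
  case (Cons x xs)
  have "filter (\<lambda>p. fst p = i) (List.product xs ys) = []" if "i \<notin> set xs"
    using that by (auto simp: filter_empty_conv)
  then show ?case using Cons by (cases "x = i") (auto simp: filter_map o_def)
qed simp

section \<open>Discrete probability\<close>

lemma prob_bind_pmf:
  "measure_pmf.prob (bind_pmf p f) E = measure_pmf.expectation p (\<lambda>x. measure_pmf.prob (f x) E)"
  by (simp add: measure_pmf_bind measure_pmf.measure_bind[where N = "count_space UNIV"]
      measure_pmf_in_subprob_space)

lemma prob_bind_pmf_le:
  assumes "\<And>x. x \<in> set_pmf p \<Longrightarrow> measure_pmf.prob (f x) E \<le> b"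
  shows "measure_pmf.prob (bind_pmf p f) E \<le> b"
proof -
  have "measure_pmf.expectation p (\<lambda>x. measure_pmf.prob (f x) E) \<le> measure_pmf.expectation p (\<lambda>_. b)"
    by (rule integral_mono_AE)
      (auto intro!: measure_pmf.integrable_const_bound[where B = 1] simp: AE_measure_pmf_iff assms)
  then show ?thesis by (simp add: prob_bind_pmf)
qed

text \<open>\<open>E\<close> can only be reached through a first stage in \<open>B\<close>, so
  failure probabilities of successive stages multiply; amplification by repetition rests on
  this.\<close>

lemma prob_bind_pmf_le_mult:
  assumes "\<And>x. x \<in> set_pmf p \<Longrightarrow> x \<in> B \<Longrightarrow> measure_pmf.prob (f x) E \<le> b"
    and "\<And>x. x \<in> set_pmf p \<Longrightarrow> x \<notin> B \<Longrightarrow> measure_pmf.prob (f x) E = 0"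
  shows "measure_pmf.prob (bind_pmf p f) E \<le> measure_pmf.prob p B * b"
proof -
  have "measure_pmf.expectation p (\<lambda>x. measure_pmf.prob (f x) E)
      \<le> measure_pmf.expectation p (\<lambda>x. indicator B x * b)"
    by (rule integral_mono_AE)
      (auto intro!: measure_pmf.integrable_const_bound[where B = 1]
        integrable_mult_left measure_pmf.integrable_const_bound[where B = 1]
        simp: AE_measure_pmf_iff assms indicator_def)
  then show ?thesis by (simp add: prob_bind_pmf)
qed

lemma prob_bind_pmf_finite:
  assumes "finite X" "set_pmf p \<subseteq> X"
  shows "measure_pmf.prob (bind_pmf p f) E = (\<Sum>x\<in>X. pmf p x * measure_pmf.prob (f x) E)"
  unfolding prob_bind_pmf using assms
  by (subst integral_measure_pmf[of X]) (auto simp: set_pmf_iff)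

text \<open>A positive total rules out the uniform fallback, and the normalised weights sum to one,
  as \<open>embed_pmf\<close> requires.\<close>

lemma pmf_proportional:
  assumes "finite C" "\<And>j. j \<in> C \<Longrightarrow> 0 \<le> w j" "0 < sum w C"
  shows "pmf (proportional_pmf C w) i = (if i \<in> C then w i / sum w C else 0)"
proof -
  have "(\<integral>\<^sup>+ i. ennreal (if i \<in> C then w i / sum w C else 0) \<partial>count_space UNIV)
      = (\<Sum>i\<in>C. ennreal (w i / sum w C))"
    using assms by (subst nn_integral_count_space'[of C]) (auto intro!: sum.cong)
  also have "\<dots> = ennreal (\<Sum>i\<in>C. w i / sum w C)"
    using assms by (intro sum_ennreal) auto
  also have "(\<Sum>i\<in>C. w i / sum w C) = 1"
    using assms by (simp flip: sum_divide_distrib)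
  finally show ?thesis
    using assms unfolding proportional_pmf_def
    by (simp only: if_False less_imp_neq[OF assms(3), symmetric])
      (subst pmf_embed_pmf, auto)
qed

lemma proportional_pmf_cong:
  assumes "\<And>j. j \<in> C \<Longrightarrow> w j = w' j"
  shows "proportional_pmf C w = proportional_pmf C w'"
  using assms unfolding proportional_pmf_def by (simp cong: if_cong sum.cong)

lemma set_proportional_pmf:
  assumes "finite C" "C \<noteq> {}" "\<And>j. j \<in> C \<Longrightarrow> 0 \<le> w j"
  shows "set_pmf (proportional_pmf C w) \<subseteq> C"
proof (cases "sum w C = 0")
  case True
  then show ?thesis using assms by (simp add: proportional_pmf_def)
next
  case False
  then have "0 < sum w C" using assms(3) by (simp add: sum_nonneg order_less_le)
  then show ?thesis using assms by (auto simp: set_pmf_iff pmf_proportional split: if_splits)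
qed

section \<open>Sums of the largest entries\<close>

text \<open>Sorting the agents by \<open>v\<close> instead of sorting the values yields a concrete
  set of \<open>l\<close> agents behind \<open>Top\<close>, so later arguments are about finite
  sums. The last property supports exchange arguments.\<close>

lemma Top_attained:
  assumes "finite C" "l \<le> card C"
  obtains Y where "Y \<subseteq> C" "card Y = l" "Top l C v = sum v Y"
    "\<And>a b. a \<in> Y \<Longrightarrow> b \<in> C - Y \<Longrightarrow> v b \<le> v a"
proof -
  define ys where "ys = rev (sort_key v (listing C))"
  have ys: "distinct ys" "set ys = C" using listing[OF assms(1)] by (auto simp: ys_def)
  have "sorted_list_of_multiset (image_mset v (mset_set C)) = sort (map v (listing C))"
    using listing[OF assms(1)]
    by (metis mset_map mset_set_set sorted_list_of_multiset_mset)
  also have "\<dots> = map v (sort_key v (listing C))"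
    by (intro properties_for_sort) (auto simp flip: mset_map simp del: mset_map, simp)
  finally have *: "rev (sorted_list_of_multiset (image_mset v (mset_set C))) = map v ys"
    by (simp add: ys_def rev_map)
  have len: "length ys = card C" using ys by (metis distinct_card)
  have srt: "sorted_wrt (\<lambda>a b. v b \<le> v a) ys"
    using sorted_sort_key[of v "listing C"] by (simp add: ys_def sorted_wrt_rev sorted_wrt_map)
  define Y where "Y = set (take l ys)"
  have dist: "distinct (take l ys)" using ys by simp
  have "C = Y \<union> set (drop l ys)" unfolding Y_def by (metis append_take_drop_id set_append ys(2))
  moreover have "v b \<le> v a" if "a \<in> Y" "b \<in> set (drop l ys)" for a b
    using srt that unfolding Y_def
    by (metis append_take_drop_id sorted_wrt_append)
  moreover have "Y \<subseteq> C" unfolding Y_def using ys(2) set_take_subset by metis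
  moreover have "card Y = l" unfolding Y_def using dist len assms(2) by (simp add: distinct_card)
  moreover have "Top l C v = sum v Y"
    unfolding Top_def * Y_def using dist by (simp add: take_map sum_list_distinct_conv_sum_set)
  ultimately show ?thesis using that by blast
qed

text \<open>Exchange argument: after cancelling the common part, \<open>X - Y\<close> has at most as
  many agents as \<open>Y - X\<close>, and each value on it is at most every value on
  \<open>Y - X\<close>.\<close>

lemma sum_le_Top:
  assumes "finite C" "l \<le> card C" "X \<subseteq> C" "card X \<le> l" "\<And>j. j \<in> C \<Longrightarrow> 0 \<le> v j"
  shows "sum v X \<le> Top l C v"
proof -
  obtain Y where Y: "Y \<subseteq> C" "card Y = l" "Top l C v = sum v Y"
    "\<And>a b. a \<in> Y \<Longrightarrow> b \<in> C - Y \<Longrightarrow> v b \<le> v a"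
    using Top_attained[OF assms(1,2)] by metis
  have fin: "finite X" "finite Y" using assms Y finite_subset by metis+
  have c: "card (X - Y) \<le> card (Y - X)"
  proof -
    have "card X = card (X \<inter> Y) + card (X - Y)" "card Y = card (X \<inter> Y) + card (Y - X)"
      using card_Int_Diff[of X Y] card_Int_Diff[of Y X] fin by (auto simp: Int_commute)
    then show ?thesis using assms(4) Y(2) by linarith
  qed
  have "sum v (X - Y) \<le> sum v (Y - X)"
  proof (cases "X - Y = {}")
    case True
    have "0 \<le> sum v (Y - X)" using assms(5) Y(1) by (intro sum_nonneg) auto
    then show ?thesis using True by (simp only: True sum.empty)
  next
    case False
    then have ne: "Y - X \<noteq> {}" using c fin by (metis card_0_eq card_gt_0_iff finite_Diff le_zero_eq not_gr_zero)
    \<comment> \<open>The smallest value on \<open>Y - X\<close> separates the two differences; as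
      it is nonnegative, its multiples compare like the cardinalities.\<close>
    define \<theta> where "\<theta> = Min (v ` (Y - X))"
    have \<theta>: "\<theta> \<in> v ` (Y - X)" "\<And>a. a \<in> Y - X \<Longrightarrow> \<theta> \<le> v a"
      unfolding \<theta>_def using fin ne by auto
    have pos: "0 \<le> \<theta>" using \<theta>(1) assms(5) Y(1) by auto
    have "v b \<le> \<theta>" if "b \<in> X - Y" for b
      using \<theta>(1) Y(4)[of _ b] that assms(3) by auto
    then have "sum v (X - Y) \<le> real (card (X - Y)) * \<theta>"
      by (intro sum_bounded_above) auto
    also have "\<dots> \<le> real (card (Y - X)) * \<theta>" using c pos by (intro mult_right_mono) auto
    also have "\<dots> \<le> sum v (Y - X)" using \<theta>(2) by (intro sum_bounded_below) auto
    finally show ?thesis .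
  qed
  moreover have "sum v X = sum v (X \<inter> Y) + sum v (X - Y)" "sum v Y = sum v (X \<inter> Y) + sum v (Y - X)"
    using sum.Int_Diff[OF fin(1), of v Y] sum.Int_Diff[OF fin(2), of v X] by (auto simp: Int_commute)
  ultimately show ?thesis using Y(3) by simp
qed

lemma Top_cong: "finite C \<Longrightarrow> (\<And>j. j \<in> C \<Longrightarrow> v j = v' j) \<Longrightarrow> Top l C v = Top l C v'"
  unfolding Top_def by (metis finite_set_mset_mset_set image_mset_cong)

lemma Top_nonneg:
  assumes "finite C" "l \<le> card C" "\<And>j. j \<in> C \<Longrightarrow> 0 \<le> v j"
  shows "0 \<le> Top l C v"
  using sum_le_Top[OF assms(1,2), of "{}" v] assms(3) by simp

lemma le_Top:
  assumes "finite C" "l \<le> card C" "1 \<le> l" "\<And>j. j \<in> C \<Longrightarrow> 0 \<le> v j" "j \<in> C"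
  shows "v j \<le> Top l C v"
  using sum_le_Top[OF assms(1,2), of "{j}" v] assms by simp

text \<open>Splitting each selected entry at \<open>t\<close> leaves \<open>l\<close> copies of
  \<open>t\<close> and an excess that is additive over agents, which is the quantity that sampling
  controls.\<close>

lemma Top_le_excess:
  assumes "finite C" "l \<le> card C"
  shows "Top l C v \<le> real l * t + (\<Sum>j\<in>C. max (v j - t) 0)"
proof -
  obtain Y where Y: "Y \<subseteq> C" "card Y = l" "Top l C v = sum v Y"
    using Top_attained[OF assms] by metis
  have "sum v Y \<le> (\<Sum>j\<in>Y. t + max (v j - t) 0)" by (intro sum_mono) auto
  also have "\<dots> = real l * t + (\<Sum>j\<in>Y. max (v j - t) 0)" by (simp add: sum.distrib Y(2))
  also have "(\<Sum>j\<in>Y. max (v j - t) 0) \<le> (\<Sum>j\<in>C. max (v j - t) 0)"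
    using assms Y by (intro sum_mono2) auto
  finally show ?thesis using Y by simp
qed

lemma Top_le_mult:
  assumes "finite C" "l \<le> card C" "\<And>j. j \<in> C \<Longrightarrow> v j \<le> b"
  shows "Top l C v \<le> real l * b"
proof -
  have "(\<Sum>j\<in>C. max (v j - b) 0) = 0" using assms(3) by (intro sum.neutral) (auto simp: max_def)
  then show ?thesis using Top_le_excess[OF assms(1,2), of v b] by simp
qed

text \<open>The \<open>l\<close> agents attaining the left-hand value also compete in both terms on
  the right.\<close>

lemma Top_le_combination:
  assumes "finite C" "l \<le> card C" "\<And>j. j \<in> C \<Longrightarrow> 0 \<le> u j" "\<And>j. j \<in> C \<Longrightarrow> 0 \<le> w j"
    and "\<And>j. j \<in> C \<Longrightarrow> v j \<le> 2 * u j + w j"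
  shows "Top l C v \<le> 2 * Top l C u + Top l C w"
proof -
  obtain Y where Y: "Y \<subseteq> C" "card Y = l" "Top l C v = sum v Y"
    using Top_attained[OF assms(1,2)] by metis
  have "sum v Y \<le> (\<Sum>j\<in>Y. 2 * u j + w j)" using assms(5) Y by (intro sum_mono) auto
  also have "\<dots> = 2 * sum u Y + sum w Y" by (simp add: sum.distrib sum_distrib_left)
  also have "\<dots> \<le> 2 * Top l C u + Top l C w"
    using sum_le_Top[OF assms(1,2) Y(1), of u] sum_le_Top[OF assms(1,2) Y(1), of w] Y(2) assms(3,4)
    by force
  finally show ?thesis using Y by simp
qed

text \<open>If more than \<open>l\<close> entries exceeded \<open>t\<close>, then \<open>l\<close>
  of them would sum to more than \<open>l * t\<close>, hence to more than \<open>Top\<close>. So the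
  entries above \<open>t\<close> are few enough to compete in \<open>Top\<close> themselves.\<close>

lemma sum_large_le_Top:
  assumes "finite C" "l \<le> card C" "1 \<le> l" "\<And>j. j \<in> C \<Longrightarrow> 0 \<le> v j" "Top l C v \<le> real l * t"
  shows "(\<Sum>j\<in>C. if t < v j then v j else 0) \<le> Top l C v"
proof -
  define H where "H = {j \<in> C. t < v j}"
  have H: "H \<subseteq> C" by (auto simp: H_def)
  have "card H \<le> l"
  proof (rule ccontr)
    assume "\<not> card H \<le> l"
    then obtain X where X: "X \<subseteq> H" "card X = l" "finite X"
      using obtain_subset_with_card_n[of l H] by auto
    then have "X \<noteq> {}" using assms(3) by auto
    then have "(\<Sum>j\<in>X. t) < sum v X" using X by (intro sum_strict_mono) (auto simp: H_def)
    also have "\<dots> \<le> Top l C v" using X H assms by (intro sum_le_Top) auto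
    finally show False using X(2) assms(5) by simp
  qed
  then have "sum v H \<le> Top l C v" using H assms by (intro sum_le_Top) auto
  then show ?thesis using assms(1) by (simp add: H_def sum.inter_filter)
qed

section \<open>Distances and the k-center subroutine\<close>

text \<open>Totality and transitivity give a least element of a finite nonempty subset, and
  antisymmetry makes it unique, so the \<open>THE\<close> denotes it. The subset is general because
  agents are also asked about their favourite open center.\<close>

lemma favourite:
  assumes "linear_order_on A r" "finite S" "S \<subseteq> A" "S \<noteq> {}"
  shows "favourite r S \<in> S" "\<And>b. b \<in> S \<Longrightarrow> (favourite r S, b) \<in> r"
proof -
  have ord: "refl_on A r" "trans r" "antisym r" "total_on A r"
    using assms(1) by (auto simp: order_on_defs)
  have "\<exists>a\<in>S. \<forall>b\<in>S. (a, b) \<in> r"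
    using assms(2,4,3)
  proof (induction rule: finite_ne_induct)
    case (singleton x)
    then show ?case using ord(1) by (auto dest: refl_onD)
  next
    case (insert x F)
    then obtain a where a: "a \<in> F" "\<forall>b\<in>F. (a, b) \<in> r" by auto
    have "x \<in> A" "a \<in> A" using insert a by auto
    then have "(a, x) \<in> r \<or> (x, a) \<in> r" using ord(1,4) by (metis refl_onD total_on_def)
    then show ?case
    proof
      assume "(a, x) \<in> r"
      then show ?case using a by auto
    next
      assume "(x, a) \<in> r"
      then have "\<forall>b\<in>F. (x, b) \<in> r" using a(2) transD[OF ord(2)] by blast
      then show ?case using refl_onD[OF ord(1) \<open>x \<in> A\<close>] by auto
    qed
  qed
  then have "\<exists>!a. a \<in> S \<and> (\<forall>b\<in>S. (a, b) \<in> r)"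
    using ord(3) by (metis antisymD)
  then have "favourite r S \<in> S \<and> (\<forall>b\<in>S. (favourite r S, b) \<in> r)"
    unfolding favourite_def by (rule theI')
  then show "favourite r S \<in> S" "\<And>b. b \<in> S \<Longrightarrow> (favourite r S, b) \<in> r" by auto
qed

lemma set_dist_le: "finite S \<Longrightarrow> a \<in> S \<Longrightarrow> set_dist d S i \<le> d i a"
  by (simp add: set_dist_def)

lemma set_dist_attained:
  assumes "finite S" "S \<noteq> {}"
  obtains a where "a \<in> S" "set_dist d S i = d i a"
proof -
  have "set_dist d S i \<in> d i ` S" unfolding set_dist_def using assms by (intro Min_in) auto
  then show ?thesis using that by auto
qed

lemma set_dist_antimono: "finite S' \<Longrightarrow> S \<noteq> {} \<Longrightarrow> S \<subseteq> S' \<Longrightarrow> set_dist d S' i \<le> set_dist d S i"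
  unfolding set_dist_def by (intro Min_antimono) auto

locale elicitation =
  fixes C :: "'c set" and A :: "'a set" and d :: "'c \<Rightarrow> 'a \<Rightarrow> real" and \<sigma> :: "'c \<Rightarrow> 'a rel"
  assumes finite_agents: "finite C" and agents_nonempty: "C \<noteq> {}"
    and finite_alternatives: "finite A" and alternatives_nonempty: "A \<noteq> {}"
    and distance: "distance_fun C A d"
    and profile: "preference_profile C A \<sigma>" and consistent: "consistent C A \<sigma> d"
begin

abbreviation peak :: "'c \<Rightarrow> 'a" where "peak j \<equiv> favourite (\<sigma> j) A"

lemma dist_nonneg: "i \<in> C \<Longrightarrow> a \<in> A \<Longrightarrow> 0 \<le> d i a"
  using distance by (auto simp: distance_fun_def)

lemma quadrangle: "i \<in> C \<Longrightarrow> j \<in> C \<Longrightarrow> a \<in> A \<Longrightarrow> b \<in> A \<Longrightarrow> d i a \<le> d i b + d j b + d j a"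
  using distance by (auto simp: distance_fun_def)

lemma finite_centers: "S \<subseteq> A \<Longrightarrow> finite S"
  using finite_alternatives finite_subset by blast

lemma linear_order: "i \<in> C \<Longrightarrow> linear_order_on A (\<sigma> i)"
  using profile by (auto simp: preference_profile_def)

text \<open>Ordinal information alone identifies a nearest alternative of \<open>S\<close>; this is
  why one query per agent reveals its distance to the whole set.\<close>

lemma dist_favourite:
  assumes "i \<in> C" "S \<subseteq> A" "S \<noteq> {}"
  shows "d i (favourite (\<sigma> i) S) = set_dist d S i"
proof -
  note fav = favourite[OF linear_order[OF assms(1)] finite_centers[OF assms(2)] assms(2,3)]
  have "d i (favourite (\<sigma> i) S) \<le> d i b" if "b \<in> S" for b
    using fav that assms consistent unfolding consistent_def by blast
  then show ?thesis
    unfolding set_dist_def using fav(1) finite_centers[OF assms(2)]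
    by (intro Min_eqI[symmetric]) auto
qed

lemma peak: assumes "j \<in> C" shows "peak j \<in> A" "a \<in> A \<Longrightarrow> d j (peak j) \<le> d j a"
proof -
  show "peak j \<in> A"
    using favourite(1)[OF linear_order[OF assms] finite_alternatives] alternatives_nonempty by simp
  show "d j (peak j) \<le> d j a" if "a \<in> A"
    using dist_favourite[OF assms subset_refl alternatives_nonempty]
      set_dist_le[OF finite_alternatives that] by simp
qed

lemma set_dist_nonneg: "j \<in> C \<Longrightarrow> S \<subseteq> A \<Longrightarrow> S \<noteq> {} \<Longrightarrow> 0 \<le> set_dist d S j"
  using set_dist_attained[of S d j] finite_centers[of S] dist_nonneg by (metis subsetD)

text \<open>The detour from \<open>j\<close> over \<open>x\<close> and \<open>s\<close> to the peak
  of \<open>s\<close> pays \<open>d s x\<close> twice, since the peak is no farther from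
  \<open>s\<close> than \<open>x\<close> is.\<close>

lemma set_dist_insert_peak:
  assumes "s \<in> C" "j \<in> C" "x \<in> A" "S \<subseteq> A"
  shows "set_dist d (insert (peak s) S) j \<le> d j x + 2 * d s x"
proof -
  have "set_dist d (insert (peak s) S) j \<le> d j (peak s)"
    using assms finite_centers by (intro set_dist_le) auto
  also have "\<dots> \<le> d j x + d s x + d s (peak s)" using assms peak by (intro quadrangle) auto
  also have "d s (peak s) \<le> d s x" using peak assms by auto
  finally show ?thesis by simp
qed

text \<open>A Lipschitz property for agents sharing the center \<open>x\<close>; it allows the
  distance of one agent to be averaged over its cluster.\<close>

lemma set_dist_quadrangle:
  assumes "s \<in> C" "j \<in> C" "x \<in> A" "S \<subseteq> A" "S \<noteq> {}"
  shows "set_dist d S s \<le> d s x + d j x + set_dist d S j"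
proof -
  obtain a where a: "a \<in> S" "set_dist d S j = d j a"
    using set_dist_attained finite_centers assms by metis
  have "set_dist d S s \<le> d s a" using a assms finite_centers by (intro set_dist_le) auto
  also have "\<dots> \<le> d s x + d j x + d j a" using a assms by (intro quadrangle) auto
  finally show ?thesis using a by simp
qed

lemma ensures_query_set_dist:
  assumes "S \<subseteq> A" "S \<noteq> {}"
  shows "ensures d C (query_set_dist C \<sigma> S) (\<lambda>v. \<forall>i\<in>C. v i = set_dist d S i) 1"
  unfolding query_set_dist_def
proof (rule ensures_bind[where a = 1 and b = 0, OF ensures_query_table])
  show "length (filter (\<lambda>p. fst p = i) (map (\<lambda>i. (i, favourite (\<sigma> i) S)) (listing C))) \<le> 1" for i
    using length_filter_eq_le_1[OF listing(1)[OF finite_agents], of i]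
    by (simp add: filter_map o_def)
qed (use listing[OF finite_agents] in \<open>auto intro!: ensures_Return simp: dist_favourite[OF _ assms]\<close>)

lemma ensures_farthest_agent:
  assumes "S \<subseteq> A" "selector sel"
  shows "ensures d C (farthest_agent sel C \<sigma> S)
    (\<lambda>s. s \<in> C \<and> (S \<noteq> {} \<longrightarrow> (\<forall>j\<in>C. set_dist d S j \<le> set_dist d S s))) 1"
proof (cases "S = {}")
  case True
  then show ?thesis
    using assms agents_nonempty by (auto simp: farthest_agent_def selector_def intro!: ensures_Return)
next
  case False
  have far: "ensures d C (Return (sel {i \<in> C. \<forall>j\<in>C. v j \<le> v i}))
    (\<lambda>s. s \<in> C \<and> (S \<noteq> {} \<longrightarrow> (\<forall>j\<in>C. set_dist d S j \<le> set_dist d S s))) 0"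
    if v: "\<forall>i\<in>C. v i = set_dist d S i" for v
  proof (rule ensures_Return)
    define s where "s = sel {i \<in> C. \<forall>j\<in>C. v j \<le> v i}"
    have ne: "{i \<in> C. \<forall>j\<in>C. v j \<le> v i} \<noteq> {}"
    proof -
      obtain i where "i \<in> C" "v i = Max (v ` C)"
        using Max_in[of "v ` C"] finite_agents agents_nonempty by (metis (no_types) finite_imageI image_iff image_is_empty)
      then show ?thesis using finite_agents by auto
    qed
    have "s \<in> {i \<in> C. \<forall>j\<in>C. v j \<le> v i}"
      unfolding s_def using assms(2)[unfolded selector_def, rule_format, OF ne] .
    then show "sel {i \<in> C. \<forall>j\<in>C. v j \<le> v i} \<in> C \<and> (S \<noteq> {} \<longrightarrow>
        (\<forall>j\<in>C. set_dist d S j \<le> set_dist d S (sel {i \<in> C. \<forall>j\<in>C. v j \<le> v i})))"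
      unfolding s_def[symmetric] using v by auto
  qed
  have "ensures d C (mechanism_bind (query_set_dist C \<sigma> S)
      (\<lambda>v. Return (sel {i \<in> C. \<forall>j\<in>C. v j \<le> v i})))
    (\<lambda>s. s \<in> C \<and> (S \<noteq> {} \<longrightarrow> (\<forall>j\<in>C. set_dist d S j \<le> set_dist d S s))) 1"
    by (rule ensures_bind[OF ensures_query_set_dist[OF assms(1) False] far]) simp_all
  then show ?thesis using False by (simp add: farthest_agent_def)
qed

text \<open>The bound on the number of uncovered clusters treats the empty set separately, because
  \<open>set_dist d {}\<close> is a junk value.\<close>

lemma ensures_k_center_loop:
  assumes "selector sel" and \<kappa>: "\<kappa> ` C \<subseteq> A" "\<And>j. j \<in> C \<Longrightarrow> d j (\<kappa> j) \<le> r"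
    and "S \<subseteq> A" "card {x \<in> \<kappa> ` C. S = {} \<or> (\<exists>j\<in>C. \<kappa> j = x \<and> 3 * r < set_dist d S j)} \<le> n"
  shows "ensures d C (k_center_loop sel C A \<sigma> n S)
    (\<lambda>S'. S' \<noteq> {} \<and> S' \<subseteq> A \<and> card S' \<le> card S + n \<and> (\<forall>j\<in>C. set_dist d S' j \<le> 3 * r)) n"
  using assms(4,5)
proof (induction n arbitrary: S)
  case 0
  then have "{x \<in> \<kappa> ` C. S = {} \<or> (\<exists>j\<in>C. \<kappa> j = x \<and> 3 * r < set_dist d S j)} = {}"
    using finite_agents by simp
  then have "S \<noteq> {}" "\<forall>j\<in>C. set_dist d S j \<le> 3 * r" using agents_nonempty by (auto simp: not_less)
  then show ?case using 0 by (auto intro!: ensures_Return)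
next
  case (Suc n)
  define far where "far S = {x \<in> \<kappa> ` C. S = {} \<or> (\<exists>j\<in>C. \<kappa> j = x \<and> 3 * r < set_dist d S j)}" for S
  have fin: "finite (far S)" for S using finite_agents by (simp add: far_def)
  have step: "ensures d C (k_center_loop sel C A \<sigma> n (insert (peak s) S))
    (\<lambda>S'. S' \<noteq> {} \<and> S' \<subseteq> A \<and> card S' \<le> card S + Suc n \<and> (\<forall>j\<in>C. set_dist d S' j \<le> 3 * r)) n"
    if s: "s \<in> C" "S \<noteq> {} \<longrightarrow> (\<forall>j\<in>C. set_dist d S j \<le> set_dist d S s)" for s
  proof -
    have sub: "insert (peak s) S \<subseteq> A" using s Suc.prems peak by auto
    have mono: "far (insert (peak s) S) \<subseteq> far S"
      using set_dist_antimono[OF finite_centers[OF sub], of S d] unfolding far_def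
      by (fastforce intro: less_le_trans)
    \<comment> \<open>The peak of \<open>s\<close> covers every agent with the same center at
      distance \<open>r + 2 * r\<close>.\<close>
    have "3 * r \<ge> set_dist d (insert (peak s) S) j" if "j \<in> C" "\<kappa> j = \<kappa> s" for j
      using set_dist_insert_peak[OF s(1) that(1), of "\<kappa> s" S] Suc.prems(1) \<kappa>(1) \<kappa>(2)[OF s(1)]
        \<kappa>(2)[OF that(1)] s(1) that(2) by (auto simp: image_subset_iff)
    then have notin: "\<kappa> s \<notin> far (insert (peak s) S)" by (force simp: far_def)
    \<comment> \<open>If some agent is beyond \<open>3 * r\<close>, then so is the farthest agent
      \<open>s\<close>, so its own center is uncovered before and covered after this iteration. For
      empty \<open>S\<close> every center counts as uncovered.\<close>
    have "\<kappa> s \<in> far S" if "far S \<noteq> {}"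
      using that s unfolding far_def by (fastforce intro: less_le_trans)
    then have "far S = {} \<or> card (far (insert (peak s) S)) < card (far S)"
      using mono notin by (auto intro!: psubset_card_mono fin)
    then have "card (far (insert (peak s) S)) \<le> n"
      using mono Suc.prems(2) by (fold far_def, auto)
    then have ens: "ensures d C (k_center_loop sel C A \<sigma> n (insert (peak s) S))
      (\<lambda>S'. S' \<noteq> {} \<and> S' \<subseteq> A \<and> card S' \<le> card (insert (peak s) S) + n \<and>
        (\<forall>j\<in>C. set_dist d S' j \<le> 3 * r)) n"
      using Suc.IH[OF sub] by (simp add: far_def)
    have "card (insert (peak s) S) \<le> Suc (card S)" by (rule card_insert_le_m1) auto
    then show ?thesis by - (rule ensures_weaken[OF ens], auto)
  qed
  show ?case
    unfolding k_center_loop.simps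
    by (rule ensures_bind[OF ensures_farthest_agent[OF Suc.prems(1) assms(1)] step]) simp_all
qed

text \<open>At the start all centers are uncovered, but there are at most \<open>k\<close> of them,
  so \<open>k\<close> iterations suffice.\<close>

lemma ensures_modified_k_center:
  assumes "selector sel" "1 \<le> k" "\<kappa> ` C \<subseteq> A" "card (\<kappa> ` C) \<le> k" "\<And>j. j \<in> C \<Longrightarrow> d j (\<kappa> j) \<le> r"
  shows "ensures d C (modified_k_center sel k C A \<sigma>)
    (\<lambda>S. S \<noteq> {} \<and> S \<subseteq> A \<and> card S \<le> k \<and> (\<forall>j\<in>C. set_dist d S j \<le> 3 * r)) k"
  unfolding modified_k_center_def
  using ensures_k_center_loop[OF assms(1,3,5), of "{}" k] assms(4) by (simp add: image_def)

text \<open>The sampling weight of an agent. The shift \<open>3 * t\<close> is what the bound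
  \<open>d j x + 2 * d s x\<close> amounts to when both distances equal \<open>t\<close>.\<close>

abbreviation excess :: "real \<Rightarrow> 'a set \<Rightarrow> 'c \<Rightarrow> real" where
  "excess t S j \<equiv> max (set_dist d S j - 3 * t) 0"

lemma ensures_adaptive_sample:
  assumes "S \<subseteq> A"
  shows "ensures d C (adaptive_sample C \<sigma> t S) (\<lambda>s. s \<in> C) 1"
proof (cases "S = {}")
  case True
  then show ?thesis
    using set_pmf_of_set[OF agents_nonempty finite_agents]
    by (auto simp: adaptive_sample_def simp del: set_pmf_of_set intro: ensures_Sample ensures_Return)
next
  case False
  have "set_pmf (proportional_pmf C (\<lambda>i. max (v i - 3 * t) 0)) \<subseteq> C" for v :: "'c \<Rightarrow> real"
    using finite_agents agents_nonempty by (intro set_proportional_pmf) auto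
  then have "ensures d C (mechanism_bind (query_set_dist C \<sigma> S)
      (\<lambda>v. Sample (proportional_pmf C (\<lambda>i. max (v i - 3 * t) 0)) Return)) (\<lambda>s. s \<in> C) 1"
    by (intro ensures_bind[OF ensures_query_set_dist[OF assms False], where b = 0]
        ensures_Sample ensures_Return) auto
  then show ?thesis using False by (simp add: adaptive_sample_def)
qed

lemma result_adaptive_sample:
  assumes "S \<subseteq> A" "S \<noteq> {}"
  shows "result_pmf d (adaptive_sample C \<sigma> t S) = proportional_pmf C (excess t S)"
proof -
  have "result_pmf d (adaptive_sample C \<sigma> t S) = bind_pmf (result_pmf d (query_set_dist C \<sigma> S))
      (\<lambda>v. proportional_pmf C (\<lambda>i. max (v i - 3 * t) 0))"
    using assms(2) by (simp add: adaptive_sample_def result_bind bind_return_pmf')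
  also have "\<dots> = bind_pmf (result_pmf d (query_set_dist C \<sigma> S)) (\<lambda>_. proportional_pmf C (excess t S))"
    by (intro bind_pmf_cong refl proportional_pmf_cong)
      (auto dest!: ensures_result[OF ensures_query_set_dist[OF assms]])
  finally show ?thesis by simp
qed

text \<open>The inclusion of \<open>S\<close> in the result later shows that the excess at the end
  of a run is at most the excess at its start.\<close>

lemma ensures_AD_sample_loop:
  assumes "S \<subseteq> A"
  shows "ensures d C (AD_sample_loop C A \<sigma> t n S)
    (\<lambda>S'. S \<subseteq> S' \<and> S' \<subseteq> A \<and> card S' \<le> card S + n \<and> (0 < n \<longrightarrow> S' \<noteq> {})) n"
  using assms
proof (induction n arbitrary: S)
  case 0
  then show ?case by (auto intro!: ensures_Return)
next
  case (Suc n)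
  have step: "ensures d C (AD_sample_loop C A \<sigma> t n (insert (peak s) S))
    (\<lambda>S'. S \<subseteq> S' \<and> S' \<subseteq> A \<and> card S' \<le> card S + Suc n \<and> (0 < Suc n \<longrightarrow> S' \<noteq> {})) n"
    if "s \<in> C" for s
  proof -
    have "card (insert (peak s) S) \<le> Suc (card S)" by (rule card_insert_le_m1) auto
    then show ?thesis
      using Suc.prems peak(1)[OF that] by - (rule ensures_weaken[OF Suc.IH], auto)
  qed
  show ?case
    unfolding AD_sample_loop.simps
    by (rule ensures_bind[OF ensures_adaptive_sample[OF Suc.prems] step]) simp_all
qed

end

section \<open>Adaptive sampling\<close>

text \<open>Clusters are the fibres of an arbitrary center map \<open>\<kappa>\<close>; its
  optimality enters only when the sum of \<open>heavy\<close> is compared with the optimum.\<close>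

locale clustering = elicitation C A d \<sigma>
  for C :: "'c set" and A :: "'a set" and d :: "'c \<Rightarrow> 'a \<Rightarrow> real" and \<sigma> :: "'c \<Rightarrow> 'a rel" +
  fixes \<kappa> :: "'c \<Rightarrow> 'a" and t :: real
  assumes centers: "\<kappa> ` C \<subseteq> A" and threshold_nonneg: "0 \<le> t"
begin

definition cluster :: "'a \<Rightarrow> 'c set" where "cluster x = {j \<in> C. \<kappa> j = x}"

text \<open>An agent above \<open>t\<close> keeps its whole distance rather than the part above
  \<open>t\<close>. Thus a positive \<open>heavy j\<close> equals the distance and exceeds
  \<open>t\<close>, while \<open>t + heavy j\<close> still bounds every distance.\<close>

definition heavy :: "'c \<Rightarrow> real" where "heavy j = (if t < d j (\<kappa> j) then d j (\<kappa> j) else 0)"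

text \<open>The factor is \<open>1 + 2 * 6\<close>: opening the peak of an agent whose heavy part is
  at most 6 times the cluster average guarantees exactly this ratio. It also leaves at most a third
  of the excess of a bad cluster to the other agents.\<close>

definition bad :: "'a set \<Rightarrow> 'a set" where
  "bad S = {x \<in> \<kappa> ` C. 13 * sum heavy (cluster x) < sum (excess t S) (cluster x)}"

lemma cluster: "finite (cluster x)" "cluster x \<subseteq> C" "j \<in> cluster x \<Longrightarrow> j \<in> C"
  "j \<in> cluster x \<Longrightarrow> \<kappa> j = x" "j \<in> cluster x \<Longrightarrow> x \<in> A"
  using finite_agents centers by (auto simp: cluster_def)

lemma finite_bad: "finite (bad S)"
  using finite_agents by (simp add: bad_def)

lemma sum_clusters: "(\<Sum>x\<in>\<kappa> ` C. sum f (cluster x)) = sum f C"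
  unfolding cluster_def using sum.image_gen[OF finite_agents, of f \<kappa>] by simp

lemma heavy_nonneg: "j \<in> C \<Longrightarrow> 0 \<le> heavy j"
  using centers dist_nonneg by (auto simp: heavy_def image_subset_iff)

lemma dist_le_heavy: "j \<in> C \<Longrightarrow> d j (\<kappa> j) \<le> t + heavy j"
  using threshold_nonneg by (simp add: heavy_def)

lemma excess_insert_le: "S \<subseteq> A \<Longrightarrow> S \<noteq> {} \<Longrightarrow> s \<in> C \<Longrightarrow> excess t (insert (peak s) S) j \<le> excess t S j"
  using set_dist_antimono[where S = S and S' = "insert (peak s) S" and d = d and i = j]
    finite_centers[of S] by (simp add: subset_insertI max.coboundedI1)

lemma bad_insert_subset:
  assumes "S \<subseteq> A" "S \<noteq> {}" "s \<in> C"
  shows "bad (insert (peak s) S) \<subseteq> bad S"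
proof -
  have "sum (excess t (insert (peak s) S)) (cluster x) \<le> sum (excess t S) (cluster x)" for x
    using excess_insert_le[OF assms] by (intro sum_mono)
  then show ?thesis unfolding bad_def by (auto intro: less_le_trans)
qed

text \<open>The shift \<open>3 * t\<close> absorbs one \<open>t\<close> from the distance of
  \<open>j\<close> and two from the detour over \<open>s\<close>, leaving
  \<open>heavy j + 2 * heavy s\<close>. Summed over the cluster, lightness of \<open>s\<close> turns
  this into \<open>1 + 2 * 6\<close> times the heavy part.\<close>

lemma cluster_becomes_good:
  assumes "S \<subseteq> A" "s \<in> C" and light: "real (card (cluster (\<kappa> s))) * heavy s \<le> 6 * sum heavy (cluster (\<kappa> s))"
  shows "\<kappa> s \<notin> bad (insert (peak s) S)"
proof -
  have "sum (excess t (insert (peak s) S)) (cluster (\<kappa> s)) \<le> (\<Sum>j\<in>cluster (\<kappa> s). heavy j + 2 * heavy s)"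
  proof (intro sum_mono)
    fix j assume j: "j \<in> cluster (\<kappa> s)"
    have "set_dist d (insert (peak s) S) j \<le> d j (\<kappa> j) + 2 * d s (\<kappa> s)"
      using set_dist_insert_peak[OF assms(2) cluster(3)[OF j] cluster(5)[OF j] assms(1)]
        cluster(4)[OF j] by simp
    then show "excess t (insert (peak s) S) j \<le> heavy j + 2 * heavy s"
      using dist_le_heavy[OF assms(2)] dist_le_heavy[OF cluster(3)[OF j]]
        heavy_nonneg[OF assms(2)] heavy_nonneg[OF cluster(3)[OF j]] by simp
  qed
  also have "\<dots> = sum heavy (cluster (\<kappa> s)) + 2 * (real (card (cluster (\<kappa> s))) * heavy s)"
    by (simp only: sum.distrib sum_constant sum_distrib_left[symmetric] mult.assoc mult.left_commute)
  also have "\<dots> \<le> 13 * sum heavy (cluster (\<kappa> s))" using light by linarith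
  finally show ?thesis by (simp add: bad_def)
qed

text \<open>Agents far above the average heavy part are few, and none of them can have much more
  excess than the cluster average: averaging the Lipschitz bound over the cluster gives
  \<open>n * excess t S s \<le> W + 2 * n * heavy s + R\<close>. Summing over \<open>X\<close>
  yields \<open>(W + 13 * R) / 6\<close>.\<close>

lemma heavy_agents_weight:
  assumes S: "S \<subseteq> A" "S \<noteq> {}" and "x \<in> bad S"
  defines "X \<equiv> {s \<in> cluster x. 6 * sum heavy (cluster x) < real (card (cluster x)) * heavy s}"
  shows "3 * sum (excess t S) X \<le> sum (excess t S) (cluster x)"
proof -
  define n where "n = real (card (cluster x))"
  define R where "R = sum heavy (cluster x)"
  define W where "W = sum (excess t S) (cluster x)"
  have W: "13 * R < W" using assms(3) by (simp add: bad_def W_def R_def)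
  have X: "X \<subseteq> cluster x" "finite X" using cluster(1) by (auto simp: X_def)
  have "cluster x \<noteq> {}" using assms(3) by (auto simp: bad_def cluster_def)
  then have n: "0 < n" using cluster(1)[of x] by (simp add: n_def card_gt_0_iff)
  have R: "0 \<le> R" unfolding R_def using heavy_nonneg cluster by (intro sum_nonneg) auto
  have "sum heavy X \<le> R"
    unfolding R_def using X cluster(1) heavy_nonneg cluster(3) by (intro sum_mono2) auto
  \<comment> \<open>Markov's inequality against the cluster average. For \<open>R = 0\<close> one
    cannot cancel \<open>R\<close>, but then all heavy parts vanish and \<open>X\<close> is
    empty.\<close>
  have few: "6 * real (card X) \<le> n"
  proof (cases "R = 0")
    case True
    have "heavy s = 0" if "s \<in> cluster x" for s
      using True sum_nonneg_eq_0_iff[of "cluster x" heavy] cluster heavy_nonneg that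
      unfolding R_def by blast
    then have "X = {}" using True by (auto simp: X_def R_def)
    then show ?thesis using n by simp
  next
    case False
    have "real (card X) * (6 * R) \<le> (\<Sum>s\<in>X. n * heavy s)"
      by (intro sum_bounded_below) (auto simp: X_def R_def n_def)
    also have "\<dots> \<le> n * R" using \<open>sum heavy X \<le> R\<close> n by (simp flip: sum_distrib_left)
    finally have "R * (6 * real (card X)) \<le> R * n" by (simp add: algebra_simps)
    then show ?thesis using False R by (simp add: mult_le_cancel_left)
  qed
  have "n * excess t S s \<le> W + 2 * n * heavy s + R" if s: "s \<in> X" for s
  proof -
    have sC: "s \<in> cluster x" "s \<in> C" using s X cluster by auto
    \<comment> \<open>Being strictly above a nonnegative multiple of the average makes
      \<open>heavy s\<close> positive, so it is the full distance of \<open>s\<close>.\<close>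
    have "0 < n * heavy s" using s R by (auto simp: X_def R_def n_def)
    then have "0 < heavy s" using n by (simp add: zero_less_mult_iff)
    then have hs: "t < heavy s" "heavy s = d s x"
      using cluster(4)[OF sC(1)] by (auto simp: heavy_def split: if_splits)
    \<comment> \<open>Since \<open>t < heavy s\<close>, the term \<open>t\<close> in \<open>d j x \<le> t + heavy j\<close> is absorbed by a second \<open>heavy s\<close>.\<close>
    have "excess t S s \<le> excess t S j + 2 * heavy s + heavy j" if j: "j \<in> cluster x" for j
      using set_dist_quadrangle[OF sC(2) cluster(3)[OF j] cluster(5)[OF j] S] hs
        dist_le_heavy[OF cluster(3)[OF j]] cluster(4)[OF j] heavy_nonneg[OF cluster(3)[OF j]]
        threshold_nonneg by auto
    then have "(\<Sum>j\<in>cluster x. excess t S s) \<le> (\<Sum>j\<in>cluster x. excess t S j + 2 * heavy s + heavy j)"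
      by (rule sum_mono)
    then show ?thesis by (simp add: sum.distrib W_def R_def n_def algebra_simps)
  qed
  then have "(\<Sum>s\<in>X. n * excess t S s) \<le> (\<Sum>s\<in>X. W + 2 * n * heavy s + R)"
    by (rule sum_mono)
  then have "n * sum (excess t S) X \<le> real (card X) * (W + R) + 2 * n * sum heavy X"
    by (simp add: sum.distrib sum_distrib_left algebra_simps)
  also have "real (card X) * (W + R) \<le> n / 6 * (W + R)"
    using few W R by (intro mult_right_mono) auto
  also have "2 * n * sum heavy X \<le> 2 * n * R" using n \<open>sum heavy X \<le> R\<close> by simp
  also have "n / 6 * (W + R) + 2 * n * R = n * ((W + 13 * R) / 6)" by (simp add: field_simps)
  finally have "n * sum (excess t S) X \<le> n * ((W + 13 * R) / 6)" by simp
  then have "sum (excess t S) X \<le> (W + 13 * R) / 6" using n by simp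
  \<comment> \<open>Badness, \<open>13 * R < W\<close>, bounds \<open>(W + 13 * R) / 6\<close> by
    \<open>W / 3\<close>.\<close>
  then show ?thesis using W by (simp add: W_def)
qed

definition progress :: "'a set \<Rightarrow> 'c set" where
  "progress S = {s \<in> C. card (bad (insert (peak s) S)) < card (bad S)}"

text \<open>As \<open>52 = 4 * 13\<close>, good clusters carry at most a quarter of the excess.
  Light agents carry two thirds of the excess in each bad cluster, and each of them repairs its
  cluster while no new cluster turns bad. This gives \<open>3 / 4 * 2 / 3 = 1 / 2\<close>.\<close>

lemma progress_weight:
  assumes S: "S \<subseteq> A" "S \<noteq> {}" and W: "52 * sum heavy C < sum (excess t S) C"
  shows "sum (excess t S) C \<le> 2 * sum (excess t S) (progress S)"
proof -
  define light where "light x = {s \<in> cluster x. real (card (cluster x)) * heavy s \<le> 6 * sum heavy (cluster x)}" for x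
  have bad_sub: "bad S \<subseteq> \<kappa> ` C" by (auto simp: bad_def)
  have "sum (excess t S) C = (\<Sum>x\<in>\<kappa> ` C. sum (excess t S) (cluster x))" by (simp add: sum_clusters)
  also have "\<dots> = (\<Sum>x\<in>\<kappa> ` C - bad S. sum (excess t S) (cluster x)) + (\<Sum>x\<in>bad S. sum (excess t S) (cluster x))"
    using bad_sub finite_agents by (intro sum.subset_diff) auto
  also have "(\<Sum>x\<in>\<kappa> ` C - bad S. sum (excess t S) (cluster x)) \<le> (\<Sum>x\<in>\<kappa> ` C - bad S. 13 * sum heavy (cluster x))"
    by (intro sum_mono) (auto simp: bad_def)
  also have "\<dots> \<le> (\<Sum>x\<in>\<kappa> ` C. 13 * sum heavy (cluster x))"
    using finite_agents heavy_nonneg cluster by (intro sum_mono2) (auto intro!: sum_nonneg)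
  also have "\<dots> = 13 * sum heavy C" by (simp add: sum_clusters flip: sum_distrib_left)
  finally have bad_weight: "3 / 4 * sum (excess t S) C \<le> (\<Sum>x\<in>bad S. sum (excess t S) (cluster x))"
    using W by simp
  have "sum (excess t S) (cluster x) \<le> 3 / 2 * sum (excess t S) (light x)" if "x \<in> bad S" for x
  proof -
    have "cluster x = light x \<union> {s \<in> cluster x. 6 * sum heavy (cluster x) < real (card (cluster x)) * heavy s}"
      by (auto simp: light_def)
    then have "sum (excess t S) (cluster x) = sum (excess t S) (light x) +
        sum (excess t S) {s \<in> cluster x. 6 * sum heavy (cluster x) < real (card (cluster x)) * heavy s}"
      using cluster(1)[of x] by (subst sum.union_disjoint[symmetric]) (auto simp: light_def)
    then show ?thesis using heavy_agents_weight[OF S that] by simp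
  qed
  then have "(\<Sum>x\<in>bad S. sum (excess t S) (cluster x)) \<le> (\<Sum>x\<in>bad S. 3 / 2 * sum (excess t S) (light x))"
    by (rule sum_mono)
  also have "\<dots> = 3 / 2 * (\<Sum>x\<in>bad S. sum (excess t S) (light x))" by (simp add: sum_distrib_left)
  also have "(\<Sum>x\<in>bad S. sum (excess t S) (light x)) = sum (excess t S) (\<Union>x\<in>bad S. light x)"
    by (rule sum.UNION_disjoint[symmetric]) (auto simp: light_def finite_bad cluster_def finite_agents)
  also have "\<dots> \<le> sum (excess t S) (progress S)"
  proof (rule sum_mono2)
    show "(\<Union>x\<in>bad S. light x) \<subseteq> progress S"
    proof safe
      fix x s assume x: "x \<in> bad S" and s: "s \<in> light x"
      have sC: "s \<in> C" "\<kappa> s = x" using s cluster by (auto simp: light_def)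
      have "x \<notin> bad (insert (peak s) S)"
        using cluster_becomes_good[OF S(1) sC(1)] s sC by (simp add: light_def)
      then have "bad (insert (peak s) S) \<subset> bad S" using bad_insert_subset[OF S sC(1)] x by auto
      then show "s \<in> progress S" using sC(1) psubset_card_mono[OF finite_bad] by (simp add: progress_def)
    qed
  qed (use finite_agents in \<open>auto simp: progress_def\<close>)
  finally show ?thesis using bad_weight by simp
qed

text \<open>The power of two is a potential that is never below one, which settles
  \<open>n = 0\<close>. While the excess is too large, a sample halves it with probability at least
  one half and never increases it, so its expectation shrinks by the factor
  \<open>3 / 4\<close>.\<close>

lemma prob_AD_sample_loop:
  assumes "S \<subseteq> A" "S \<noteq> {}"
  shows "measure_pmf.prob (result_pmf d (AD_sample_loop C A \<sigma> t n S))
      {S'. 52 * sum heavy C < sum (excess t S') C} \<le> 2 ^ card (bad S) * (3 / 4) ^ n"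
  using assms
proof (induction n arbitrary: S)
  case 0
  have "measure_pmf.prob (result_pmf d (AD_sample_loop C A \<sigma> t 0 S))
      {S'. 52 * sum heavy C < sum (excess t S') C} \<le> 1"
    by (rule measure_pmf.prob_le_1)
  also have "\<dots> \<le> 2 ^ card (bad S) * (3 / 4) ^ 0" by simp
  finally show ?case .
next
  case (Suc n)
  define W where "W = sum (excess t S) C"
  let ?E = "{S'. 52 * sum heavy C < sum (excess t S') C}"
  let ?run = "\<lambda>n S. result_pmf d (AD_sample_loop C A \<sigma> t n S)"
  show ?case
  proof (cases "52 * sum heavy C < W")
    \<comment> \<open>Adding centers cannot increase the excess, so once it is small enough the
      failure event is impossible.\<close>
    case False
    have "sum (excess t S') C \<le> W" if "S' \<in> set_pmf (?run (Suc n) S)" for S'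
    proof -
      have S': "S \<subseteq> S'" "S' \<subseteq> A"
        using ensures_result[OF ensures_AD_sample_loop[OF Suc.prems(1)] that] by auto
      then have "set_dist d S' j \<le> set_dist d S j" for j
        using S' Suc.prems(2) by (intro set_dist_antimono finite_centers)
      then show ?thesis unfolding W_def by (intro sum_mono) (simp add: max.coboundedI1)
    qed
    then have "set_pmf (?run (Suc n) S) \<inter> ?E = {}" using False by fastforce
    then have "measure_pmf.prob (?run (Suc n) S) ?E = 0" by (simp add: measure_pmf_zero_iff)
    then show ?thesis by simp
  next
    case True
    define F where "F = 2 ^ card (bad S) * (3 / 4 :: real) ^ n"
    have F: "0 \<le> F" by (simp add: F_def)
    have "0 \<le> sum heavy C" using heavy_nonneg by (rule sum_nonneg)
    then have W: "0 < W" using True by linarith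
    let ?p = "proportional_pmf C (excess t S)"
    have pmf: "pmf ?p s = excess t S s / W" if "s \<in> C" for s
      using W that by (subst pmf_proportional) (auto simp: finite_agents W_def)
    have step: "measure_pmf.prob (?run n (insert (peak s) S)) ?E \<le> (if s \<in> progress S then F / 2 else F)"
      if s: "s \<in> C" for s
    proof -
      let ?b = "card (bad (insert (peak s) S))"
      have "(2 :: real) ^ ?b \<le> (if s \<in> progress S then 2 ^ card (bad S) / 2 else 2 ^ card (bad S))"
      proof (cases "s \<in> progress S")
        case True
        then have "Suc ?b \<le> card (bad S)" by (simp add: progress_def)
        then have "(2 :: real) ^ Suc ?b \<le> 2 ^ card (bad S)" by (intro power_increasing) auto
        then show ?thesis using True by simp
      next
        case False
        have "?b \<le> card (bad S)" by (intro card_mono finite_bad bad_insert_subset Suc.prems s)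
        then show ?thesis using False by (simp add: power_increasing)
      qed
      from mult_right_mono[OF this, of "(3 / 4) ^ n"]
      have "2 ^ ?b * (3 / 4) ^ n \<le> (if s \<in> progress S then F / 2 else F)"
        by (simp add: F_def split: if_splits)
      moreover have "measure_pmf.prob (?run n (insert (peak s) S)) ?E \<le> 2 ^ ?b * (3 / 4) ^ n"
        using Suc.prems peak(1)[OF s] by (intro Suc.IH) auto
      ultimately show ?thesis by linarith
    qed
    have "measure_pmf.prob (?run (Suc n) S) ?E =
        measure_pmf.prob (bind_pmf ?p (\<lambda>s. ?run n (insert (peak s) S))) ?E"
      by (simp add: result_bind result_adaptive_sample[OF Suc.prems])
    also have "\<dots> = (\<Sum>s\<in>C. pmf ?p s * measure_pmf.prob (?run n (insert (peak s) S)) ?E)"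
      by (intro prob_bind_pmf_finite finite_agents set_proportional_pmf agents_nonempty) auto
    also have "\<dots> \<le> (\<Sum>s\<in>C. excess t S s / W * (if s \<in> progress S then F / 2 else F))"
      using W by (intro sum_mono mult_mono) (auto simp: pmf step)
    also have "\<dots> = (\<Sum>s\<in>C. F / W * excess t S s - (if s \<in> progress S then F / (2 * W) * excess t S s else 0))"
      by (intro sum.cong) (auto simp: field_simps)
    also have "\<dots> = F / W * W - F / (2 * W) * sum (excess t S) (progress S)"
    proof -
      have "(\<Sum>s\<in>C. if s \<in> progress S then F / (2 * W) * excess t S s else (0 :: real))
          = (\<Sum>s\<in>progress S. F / (2 * W) * excess t S s)"
        using finite_agents by (simp add: sum.inter_filter[symmetric] progress_def)
      then show ?thesis by (simp only: sum_subtractf W_def sum_distrib_left)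
    qed
    \<comment> \<open>Agents in \<open>progress S\<close> carry at least half of the weight and save
      half of \<open>F\<close>, whence \<open>1 - 1 / 2 * 1 / 2\<close>.\<close>
    also have "\<dots> \<le> F / W * W - F / (2 * W) * (W / 2)"
      using progress_weight[OF Suc.prems] True W F
      by (intro diff_left_mono mult_left_mono) (auto simp: W_def)
    also have "\<dots> = 2 ^ card (bad S) * (3 / 4) ^ Suc n" using W by (simp add: F_def field_simps)
    finally show ?thesis .
  qed
qed

end

section \<open>Success probability of one sampling run\<close>

lemma number_of_samples:
  assumes "1 \<le> k"
  shows "38 * k + 1 \<le> nat \<lceil>38 * (real k + sqrt (real k))\<rceil>"
    and "nat \<lceil>38 * (real k + sqrt (real k))\<rceil> \<le> 77 * k"
proof -
  define r where "r = sqrt (real k)"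
  \<comment> \<open>The lower bound on the root pays for the extra first sample, the upper bound
    makes the number of samples linear in \<open>k\<close>.\<close>
  have "1 \<le> r" "r \<le> real k"
    using assms by (simp_all add: r_def real_le_lsqrt power2_eq_square)
  then have "real (38 * k + 1) \<le> 38 * (real k + r)" "38 * (real k + r) \<le> real (77 * k)"
    by simp_all
  then show "38 * k + 1 \<le> nat \<lceil>38 * (real k + sqrt (real k))\<rceil>"
    and "nat \<lceil>38 * (real k + sqrt (real k))\<rceil> \<le> 77 * k"
    unfolding r_def[symmetric] by linarith+
qed

text \<open>The first, uniform sample only makes the center set nonempty. The other samples, at
  least \<open>38 * k\<close>, face at most \<open>k\<close> bad clusters, and
  \<open>2 * (3 / 4) ^ 38\<close> is far below one.\<close>

lemma (in clustering) prob_AD_sample_Top_Gen: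
  assumes "1 \<le> k" "card (\<kappa> ` C) \<le> k"
  shows "measure_pmf.prob (result_pmf d (AD_sample_Top_Gen k C A \<sigma> t))
      {S'. 52 * sum heavy C < sum (excess t S') C} \<le> exp (- 1)"
proof -
  define N where "N = nat \<lceil>38 * (real k + sqrt (real k))\<rceil>"
  have "38 * k + 1 \<le> N" using number_of_samples(1)[OF assms(1)] by (simp only: N_def)
  then obtain n where n: "N = Suc n" "38 * k \<le> n" by (cases N) auto
  have first: "measure_pmf.prob (result_pmf d (AD_sample_loop C A \<sigma> t n {peak s}))
      {S'. 52 * sum heavy C < sum (excess t S') C} \<le> exp (- 1)" if "s \<in> C" for s
  proof -
    have "measure_pmf.prob (result_pmf d (AD_sample_loop C A \<sigma> t n {peak s}))
        {S'. 52 * sum heavy C < sum (excess t S') C} \<le> 2 ^ card (bad {peak s}) * (3 / 4) ^ n"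
      using peak(1)[OF that] by (intro prob_AD_sample_loop) auto
    also have "\<dots> \<le> 2 ^ k * (3 / 4) ^ (38 * k)"
    proof -
      have "card (bad {peak s}) \<le> card (\<kappa> ` C)"
        using finite_agents by (intro card_mono) (auto simp: bad_def)
      then have "(2 :: real) ^ card (bad {peak s}) \<le> 2 ^ k"
        using assms(2) by (intro power_increasing) auto
      moreover have "(3 / 4 :: real) ^ n \<le> (3 / 4) ^ (38 * k)"
        using n(2) by (intro power_decreasing) auto
      ultimately show ?thesis by (rule mult_mono) auto
    qed
    also have "\<dots> = (2 * (3 / 4) ^ 38) ^ k" by (simp add: power_mult power_mult_distrib)
    also have "\<dots> \<le> (2 * (3 / 4) ^ 38) ^ 1"
      using assms(1) by (intro power_decreasing) (auto simp: field_simps)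
    also have "\<dots> \<le> (1 / 3 :: real)" by (simp add: field_simps)
    \<comment> \<open>\<open>exp_le\<close> states \<open>exp 1 \<le> 3\<close>.\<close>
    also have "\<dots> \<le> exp (- 1)" using exp_le by (simp add: exp_minus field_simps)
    finally show ?thesis .
  qed
  have "measure_pmf.prob (bind_pmf (result_pmf d (adaptive_sample C \<sigma> t {}))
      (\<lambda>s. result_pmf d (AD_sample_loop C A \<sigma> t n {peak s})))
      {S'. 52 * sum heavy C < sum (excess t S') C} \<le> exp (- 1)"
    using ensures_result[OF ensures_adaptive_sample[OF empty_subsetI]]
    by (intro prob_bind_pmf_le first)
  then show ?thesis
    unfolding AD_sample_Top_Gen_def N_def[symmetric] n(1) by (simp add: result_bind)
qed

section \<open>Candidates collected over a list of guesses\<close>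

context elicitation
begin

lemma ensures_AD_sample_Top_Gen:
  assumes "1 \<le> k"
  shows "ensures d C (AD_sample_Top_Gen k C A \<sigma> t)
    (\<lambda>S. S \<subseteq> A \<and> S \<noteq> {} \<and> card S \<le> 77 * k) (77 * k)"
proof -
  define n where "n = nat \<lceil>38 * (real k + sqrt (real k))\<rceil>"
  have "38 * k + 1 \<le> n" "n \<le> 77 * k" using number_of_samples[OF assms] by (simp_all only: n_def)
  then show ?thesis
    unfolding AD_sample_Top_Gen_def n_def[symmetric]
    by - (rule ensures_weaken[OF ensures_AD_sample_loop[OF empty_subsetI]], auto)
qed

text \<open>Per guess, sampling takes at most \<open>77 * k\<close> queries to each agent and
  evaluating the sampled set takes one more.\<close>

lemma ensures_sample_candidates:
  assumes "1 \<le> k"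
  shows "ensures d C (sample_candidates k l C A \<sigma> ts)
    (\<lambda>cands. length cands = length ts \<and> (\<forall>(S, c) \<in> set cands.
       S \<subseteq> A \<and> S \<noteq> {} \<and> card S \<le> 77 * k \<and> c = Top l C (set_dist d S)))
    (length ts * (77 * k + 1))"
proof (induction ts)
  case Nil
  show ?case by (simp add: ensures_Return)
next
  case (Cons t ts)
  show ?case
    unfolding sample_candidates.simps
  proof (rule ensures_bind[OF ensures_AD_sample_Top_Gen[OF assms]])
    fix S assume S: "S \<subseteq> A \<and> S \<noteq> {} \<and> card S \<le> 77 * k"
    show "ensures d C
      (mechanism_bind (query_set_dist C \<sigma> S) (\<lambda>v. mechanism_bind (sample_candidates k l C A \<sigma> ts)
        (\<lambda>cands. Return ((S, Top l C v) # cands))))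
      (\<lambda>cands. length cands = length (t # ts) \<and> (\<forall>(S, c) \<in> set cands.
         S \<subseteq> A \<and> S \<noteq> {} \<and> card S \<le> 77 * k \<and> c = Top l C (set_dist d S)))
      (1 + (length ts * (77 * k + 1) + 0))"
    proof (rule ensures_bind[OF ensures_query_set_dist])
      fix v assume "\<forall>i\<in>C. v i = set_dist d S i"
      then have "Top l C v = Top l C (set_dist d S)" by (intro Top_cong finite_agents) auto
      then show "ensures d C (mechanism_bind (sample_candidates k l C A \<sigma> ts)
          (\<lambda>cands. Return ((S, Top l C v) # cands)))
        (\<lambda>cands. length cands = length (t # ts) \<and> (\<forall>(S, c) \<in> set cands.
           S \<subseteq> A \<and> S \<noteq> {} \<and> card S \<le> 77 * k \<and> c = Top l C (set_dist d S)))
        (length ts * (77 * k + 1) + 0)"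
        using S by (intro ensures_bind[OF Cons] ensures_Return) auto
    qed (use S in auto)
  qed simp
qed

text \<open>The runs use independent randomness, and all candidates exceed \<open>b\<close> only if
  those of all runs with guess \<open>t\<close> do. Runs with other guesses contribute a factor of
  at most one.\<close>

lemma prob_sample_candidates:
  assumes "1 \<le> k"
    and p: "measure_pmf.prob (result_pmf d (AD_sample_Top_Gen k C A \<sigma> t))
      {S. b < Top l C (set_dist d S)} \<le> p"
  shows "measure_pmf.prob (result_pmf d (sample_candidates k l C A \<sigma> ts))
      {cands. \<forall>(S, c) \<in> set cands. b < c} \<le> p ^ count_list ts t"
proof (induction ts)
  case Nil
  show ?case by simp
next
  case (Cons t' ts)
  let ?E = "{cands. \<forall>(S, c) \<in> set cands. b < c}"
  let ?cands = "result_pmf d (sample_candidates k l C A \<sigma> ts)"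
  define rest where "rest = (\<lambda>S. result_pmf d
    (mechanism_bind (query_set_dist C \<sigma> S) (\<lambda>v. mechanism_bind (sample_candidates k l C A \<sigma> ts)
      (\<lambda>cands. Return ((S, Top l C v) # cands)))))"
  have p0: "0 \<le> p" using p measure_nonneg order_trans by blast
  \<comment> \<open>A head candidate of cost at most \<open>b\<close> already excludes the event,
    hence the value \<open>0\<close>.\<close>
  have rest: "measure_pmf.prob (rest S) ?E \<le> (if b < Top l C (set_dist d S) then p ^ count_list ts t else 0)"
    if "S \<in> set_pmf (result_pmf d (AD_sample_Top_Gen k C A \<sigma> t'))" for S
    unfolding rest_def result_bind
  proof (rule prob_bind_pmf_le)
    fix v assume v: "v \<in> set_pmf (result_pmf d (query_set_dist C \<sigma> S))"
    have S: "S \<subseteq> A" "S \<noteq> {}"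
      using ensures_result[OF ensures_AD_sample_Top_Gen[OF assms(1)] that] by auto
    have "Top l C v = Top l C (set_dist d S)"
      using ensures_result[OF ensures_query_set_dist[OF S] v] by (intro Top_cong finite_agents) auto
    then have "bind_pmf ?cands (\<lambda>cands. result_pmf d (Return ((S, Top l C v) # cands))) =
        map_pmf ((#) (S, Top l C (set_dist d S))) ?cands"
      by (simp add: map_pmf_def)
    moreover have "measure_pmf.prob (map_pmf ((#) (S, Top l C (set_dist d S))) ?cands) ?E \<le>
        (if b < Top l C (set_dist d S) then p ^ count_list ts t else 0)"
      using Cons by (auto simp: vimage_def)
    ultimately show "measure_pmf.prob
        (bind_pmf ?cands (\<lambda>cands. result_pmf d (Return ((S, Top l C v) # cands)))) ?E \<le>
        (if b < Top l C (set_dist d S) then p ^ count_list ts t else 0)" by simp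
  qed
  have eq: "result_pmf d (sample_candidates k l C A \<sigma> (t' # ts)) =
      bind_pmf (result_pmf d (AD_sample_Top_Gen k C A \<sigma> t')) rest"
    by (simp only: sample_candidates.simps result_bind rest_def)
  show ?case
  proof (cases "t' = t")
    case True
    have "measure_pmf.prob (bind_pmf (result_pmf d (AD_sample_Top_Gen k C A \<sigma> t')) rest) ?E \<le>
        measure_pmf.prob (result_pmf d (AD_sample_Top_Gen k C A \<sigma> t'))
          {S. b < Top l C (set_dist d S)} * p ^ count_list ts t"
    proof (rule prob_bind_pmf_le_mult)
      fix S assume S: "S \<in> set_pmf (result_pmf d (AD_sample_Top_Gen k C A \<sigma> t'))"
      show "measure_pmf.prob (rest S) ?E \<le> p ^ count_list ts t" if "S \<in> {S. b < Top l C (set_dist d S)}"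
        using rest[OF S] that by simp
      show "measure_pmf.prob (rest S) ?E = 0" if "S \<notin> {S. b < Top l C (set_dist d S)}"
        using rest[OF S] that by (simp add: measure_le_0_iff)
    qed
    also have "\<dots> \<le> p * p ^ count_list ts t" using p p0 True by (intro mult_right_mono) auto
    finally show ?thesis using True unfolding eq by simp
  next
    case False
    have "measure_pmf.prob (rest S) ?E \<le> p ^ count_list ts t"
      if "S \<in> set_pmf (result_pmf d (AD_sample_Top_Gen k C A \<sigma> t'))" for S
      using rest[OF that] p0 by (auto split: if_splits intro: order_trans)
    then show ?thesis using False unfolding eq by (auto intro!: prob_bind_pmf_le)
  qed
qed

end

lemma count_list_concat_replicate:
  "count_list (concat (map (replicate m) xs)) x = m * count_list xs x"
proof -
  have "count_list (replicate m y) x = (if x = y then m else 0)" for y by (induction m) auto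
  then show ?thesis by (induction xs) (auto simp: algebra_simps)
qed

section \<open>The optimum and its restriction to a candidate set\<close>

lemma
  assumes "finite A" "A \<noteq> {}" "1 \<le> k"
  shows OPT_attained: "\<exists>S. S \<subseteq> A \<and> S \<noteq> {} \<and> card S \<le> k \<and> Top l C (set_dist d S) = OPT k l C A d"
    and OPT_le: "S \<subseteq> A \<Longrightarrow> S \<noteq> {} \<Longrightarrow> card S \<le> k \<Longrightarrow> OPT k l C A d \<le> Top l C (set_dist d S)"
proof -
  let ?X = "{Top l C (set_dist d S) | S. S \<subseteq> A \<and> S \<noteq> {} \<and> card S \<le> k}"
  have "?X \<subseteq> (\<lambda>S. Top l C (set_dist d S)) ` Pow A" by auto
  then have fin: "finite ?X" using assms(1) by (meson finite_Pow_iff finite_imageI finite_subset)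
  obtain a where "a \<in> A" using assms(2) by auto
  then have "Top l C (set_dist d {a}) \<in> ?X" using assms(3) by (intro CollectI exI[of _ "{a}"]) auto
  then have "OPT k l C A d \<in> ?X" unfolding OPT_def using fin by (intro Min_in) auto
  then show "\<exists>S. S \<subseteq> A \<and> S \<noteq> {} \<and> card S \<le> k \<and> Top l C (set_dist d S) = OPT k l C A d" by force
  show "OPT k l C A d \<le> Top l C (set_dist d S)" if "S \<subseteq> A" "S \<noteq> {}" "card S \<le> k"
    unfolding OPT_def using that by (intro Min_le fin) auto
qed

lemma set_dist_cong: "(\<And>a. a \<in> S \<Longrightarrow> D i a = d i a) \<Longrightarrow> set_dist D S i = set_dist d S i"
  unfolding set_dist_def by (metis image_cong)

text \<open>The approximation algorithm sees a table of answers, which is known to agree with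
  \<open>d\<close> on the queried pairs only.\<close>

lemma OPT_cong:
  assumes "finite C" "\<And>i a. i \<in> C \<Longrightarrow> a \<in> P \<Longrightarrow> D i a = d i a"
  shows "OPT k l C P D = OPT k l C P d"
proof -
  have "Top l C (set_dist D S) = Top l C (set_dist d S)" if "S \<subseteq> P" for S
    using assms that by (intro Top_cong set_dist_cong) auto
  then have "{Top l C (set_dist D S) | S. S \<subseteq> P \<and> S \<noteq> {} \<and> card S \<le> k} =
      {Top l C (set_dist d S) | S. S \<subseteq> P \<and> S \<noteq> {} \<and> card S \<le> k}" by metis
  then show ?thesis by (simp add: OPT_def)
qed

context elicitation
begin

text \<open>Replaces an optimal set by an assignment of agents to nearest centers, whose fibres then
  serve as clusters.\<close>

lemma OPT_center_map:
  assumes "1 \<le> k"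
  obtains \<kappa> where "\<kappa> ` C \<subseteq> A" "card (\<kappa> ` C) \<le> k" "Top l C (\<lambda>j. d j (\<kappa> j)) = OPT k l C A d"
proof -
  obtain S where S: "S \<subseteq> A" "S \<noteq> {}" "card S \<le> k" "Top l C (set_dist d S) = OPT k l C A d"
    using OPT_attained[OF finite_alternatives alternatives_nonempty assms] by metis
  have "\<forall>j. \<exists>a. a \<in> S \<and> set_dist d S j = d j a"
    using set_dist_attained[OF finite_centers[OF S(1)] S(2)] by metis
  then obtain \<kappa> where \<kappa>: "\<And>j. \<kappa> j \<in> S" "\<And>j. set_dist d S j = d j (\<kappa> j)" by metis
  have "card (\<kappa> ` C) \<le> card S" using \<kappa>(1) finite_centers[OF S(1)] by (intro card_mono) auto
  moreover have "set_dist d S = (\<lambda>j. d j (\<kappa> j))" using \<kappa>(2) by blast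
  ultimately show ?thesis using that[of \<kappa>] S \<kappa>(1) by auto
qed

text \<open>Moving an optimal center to the candidate nearest to an agent of its cluster that minimizes
  the sum of the distances to both costs at most the sum of these two distances.\<close>

lemma OPT_restrict_le:
  assumes "1 \<le> k" "l \<le> card C" "S \<subseteq> A" "S \<noteq> {}"
  shows "OPT k l C S d \<le> 2 * OPT k l C A d + Top l C (set_dist d S)"
proof -
  obtain \<kappa> where \<kappa>: "\<kappa> ` C \<subseteq> A" "card (\<kappa> ` C) \<le> k" "Top l C (\<lambda>j. d j (\<kappa> j)) = OPT k l C A d"
    using OPT_center_map[OF assms(1)] by metis
  define f where "f j = d j (\<kappa> j) + set_dist d S j" for j
  define rep where "rep x = arg_min_on f {j \<in> C. \<kappa> j = x}" for x
  have rep: "rep (\<kappa> j) \<in> C" "\<kappa> (rep (\<kappa> j)) = \<kappa> j" "f (rep (\<kappa> j)) \<le> f j" if "j \<in> C" for j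
  proof -
    have ne: "finite {i \<in> C. \<kappa> i = \<kappa> j}" "{i \<in> C. \<kappa> i = \<kappa> j} \<noteq> {}"
      using finite_agents that by auto
    from arg_min_if_finite[OF ne, of f] that
    show "rep (\<kappa> j) \<in> C" "\<kappa> (rep (\<kappa> j)) = \<kappa> j" "f (rep (\<kappa> j)) \<le> f j"
      unfolding rep_def by (auto simp: not_less)
  qed
  have "\<forall>j. \<exists>a. a \<in> S \<and> set_dist d S j = d j a"
    using set_dist_attained[OF finite_centers[OF assms(3)] assms(4)] by metis
  then obtain c where c: "\<And>j. c j \<in> S" "\<And>j. set_dist d S j = d j (c j)" by metis
  define T where "T = (\<lambda>x. c (rep x)) ` \<kappa> ` C"
  have T: "T \<subseteq> S" "T \<noteq> {}" "card T \<le> k"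
  proof -
    show "T \<subseteq> S" "T \<noteq> {}" using c agents_nonempty by (auto simp: T_def)
    show "card T \<le> k" unfolding T_def using card_image_le[of "\<kappa> ` C"] finite_agents \<kappa>(2)
      by (meson finite_imageI order_trans)
  qed
  have "set_dist d T j \<le> 2 * d j (\<kappa> j) + set_dist d S j" if j: "j \<in> C" for j
  proof -
    have "set_dist d T j \<le> d j (c (rep (\<kappa> j)))"
      using T(1) assms(3) finite_centers j by (intro set_dist_le) (auto simp: T_def)
    \<comment> \<open>The quadrangle inequality runs through the optimal center shared with the
      representative; the last two terms are \<open>f\<close> at the representative, which minimizes
      \<open>f\<close> on the cluster.\<close>
    also have "\<dots> \<le> d j (\<kappa> j) + d (rep (\<kappa> j)) (\<kappa> j) + d (rep (\<kappa> j)) (c (rep (\<kappa> j)))"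
      using j rep(1)[OF j] \<kappa>(1) c(1) assms(3) by (intro quadrangle) auto
    also have "\<dots> = d j (\<kappa> j) + f (rep (\<kappa> j))" using rep(2)[OF j] c(2) by (simp add: f_def)
    also have "\<dots> \<le> d j (\<kappa> j) + f j" using rep(3)[OF j] by simp
    finally show ?thesis by (simp add: f_def)
  qed
  then have "Top l C (set_dist d T) \<le> 2 * Top l C (\<lambda>j. d j (\<kappa> j)) + Top l C (set_dist d S)"
    using dist_nonneg \<kappa>(1) set_dist_nonneg assms
    by (intro Top_le_combination finite_agents) auto
  then show ?thesis
    using OPT_le[OF finite_centers[OF assms(3)] assms(4,1) T, of l C d] \<kappa>(3) by simp
qed

text \<open>\<open>D\<close> is what the final table of queries returns. It is a distance function
  on \<open>S\<close>, and costs and optimum within \<open>S\<close> read it only where it agrees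
  with \<open>d\<close>.\<close>

lemma centrum_approximation_on_candidates:
  assumes "centrum_approximation \<rho> k l alg" "l \<le> card C" "S \<subseteq> A" "S \<noteq> {}"
  defines "D \<equiv> \<lambda>i a. if i \<in> C \<and> a \<in> S then d i a else 0"
  shows "alg C S D \<subseteq> S" "alg C S D \<noteq> {}" "card (alg C S D) \<le> k"
    "Top l C (set_dist d (alg C S D)) \<le> \<rho> * OPT k l C S d"
proof -
  have "distance_fun C S D"
    unfolding distance_fun_def D_def using dist_nonneg quadrangle assms(3) by (simp add: subset_iff)
  then have *: "alg C S D \<subseteq> S \<and> alg C S D \<noteq> {} \<and> card (alg C S D) \<le> k \<and>
      Top l C (set_dist D (alg C S D)) \<le> \<rho> * OPT k l C S D"
    using assms(1,2,4) finite_agents finite_centers[OF assms(3)]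
    unfolding centrum_approximation_def by blast
  then show "alg C S D \<subseteq> S" "alg C S D \<noteq> {}" "card (alg C S D) \<le> k" by auto
  have "OPT k l C S D = OPT k l C S d" by (intro OPT_cong finite_agents) (simp add: D_def)
  moreover have "Top l C (set_dist D (alg C S D)) = Top l C (set_dist d (alg C S D))"
    using * by (intro Top_cong finite_agents set_dist_cong) (auto simp: D_def)
  ultimately show "Top l C (set_dist d (alg C S D)) \<le> \<rho> * OPT k l C S d" using * by simp
qed

text \<open>A guess with \<open>l * t\<close> at least the optimum keeps the sum of
  \<open>heavy\<close> below the optimum, and \<open>Top_le_excess\<close> at threshold
  \<open>3 * t\<close> converts the bound on the excess into a bound on the cost.\<close>

lemma prob_AD_sample_cost:
  assumes "1 \<le> k" "1 \<le> l" "l \<le> card C" "OPT k l C A d \<le> real l * t"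
  shows "measure_pmf.prob (result_pmf d (AD_sample_Top_Gen k C A \<sigma> t))
    {S. 3 * real l * t + 52 * OPT k l C A d < Top l C (set_dist d S)} \<le> exp (- 1)"
proof -
  obtain \<kappa> where \<kappa>: "\<kappa> ` C \<subseteq> A" "card (\<kappa> ` C) \<le> k" "Top l C (\<lambda>j. d j (\<kappa> j)) = OPT k l C A d"
    using OPT_center_map[OF assms(1)] by metis
  have nonneg: "0 \<le> d j (\<kappa> j)" if "j \<in> C" for j using dist_nonneg \<kappa>(1) that by auto
  have "0 \<le> OPT k l C A d" using Top_nonneg[of C l "\<lambda>j. d j (\<kappa> j)"] finite_agents assms(3) nonneg \<kappa>(3) by simp
  then have "0 \<le> real l * t" using assms(4) by linarith
  then have t: "0 \<le> t" using assms(2) by (simp add: zero_le_mult_iff)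
  interpret clustering C A d \<sigma> \<kappa> t
    using \<kappa>(1) t by unfold_locales
  have "sum heavy C \<le> OPT k l C A d"
    using sum_large_le_Top[OF finite_agents assms(3,2), of "\<lambda>j. d j (\<kappa> j)" t] nonneg assms(4) \<kappa>(3)
    by (simp add: heavy_def)
  moreover have "Top l C (set_dist d S) \<le> 3 * real l * t + sum (excess t S) C" for S
    using Top_le_excess[OF finite_agents assms(3), of "set_dist d S" "3 * t"] by simp
  ultimately have "{S. 3 * real l * t + 52 * OPT k l C A d < Top l C (set_dist d S)} \<subseteq>
      {S. 52 * sum heavy C < sum (excess t S) C}" by (smt (verit) Collect_mono)
  then have "measure_pmf.prob (result_pmf d (AD_sample_Top_Gen k C A \<sigma> t))
      {S. 3 * real l * t + 52 * OPT k l C A d < Top l C (set_dist d S)} \<le>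
    measure_pmf.prob (result_pmf d (AD_sample_Top_Gen k C A \<sigma> t)) {S. 52 * sum heavy C < sum (excess t S) C}"
    by (intro measure_pmf.finite_measure_mono) auto
  then show ?thesis using prob_AD_sample_Top_Gen[OF assms(1) \<kappa>(2)] by linarith
qed

end

section \<open>The mechanism\<close>

lemma threshold_guesses_eq:
  "threshold_guesses \<epsilon> l B = (\<lambda>r. real l * B * (1 + \<epsilon>) powr (- real r)) `
     {..nat \<lceil>log (1 + \<epsilon>) (3 * (real l)\<^sup>2 / \<epsilon>)\<rceil>}"
  by (auto simp: threshold_guesses_def)

text \<open>Consecutive guesses differ by the factor \<open>1 + \<epsilon>\<close>, so the guess
  just before the first one that is too small fits. If none is too small, the smallest fits because
  the range of exponents is long enough. The two bounds on \<open>B\<close> are those provided by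
  the k-center stage.\<close>

lemma threshold_guess_exists:
  assumes "0 < \<epsilon>" "1 \<le> l" "0 \<le> opt" "opt \<le> real l * B" "B \<le> 3 * opt"
  obtains t where "t \<in> threshold_guesses \<epsilon> l B" "opt \<le> real l * t" "real l * t \<le> (1 + \<epsilon>) * opt"
proof -
  define m where "m = nat \<lceil>log (1 + \<epsilon>) (3 * (real l)\<^sup>2 / \<epsilon>)\<rceil>"
  define g where "g r = real l * B * (1 + \<epsilon>) powr (- real r)" for r
  have l: "1 \<le> real l" using assms(2) by simp
  have guess: "g r \<in> threshold_guesses \<epsilon> l B" if "r \<le> m" for r
    using that by (auto simp: threshold_guesses_eq g_def m_def)
  have "0 \<le> real l * B" using assms(3,4) by linarith
  then have B: "0 \<le> B" using l by (simp add: zero_le_mult_iff)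
  show thesis
  proof (cases "\<forall>r\<le>m. opt \<le> real l * g r")
    case True
    \<comment> \<open>The end of the range makes \<open>l * g m\<close> at most
      \<open>l * l * B * \<epsilon> / (3 * l * l)\<close>, which is
      \<open>\<epsilon> * B / 3\<close> and hence at most \<open>\<epsilon> * opt\<close>.\<close>
    have "log (1 + \<epsilon>) (3 * (real l)\<^sup>2 / \<epsilon>) \<le> real m" unfolding m_def by linarith
    then have "(1 + \<epsilon>) powr (- real m) \<le> (1 + \<epsilon>) powr (- log (1 + \<epsilon>) (3 * (real l)\<^sup>2 / \<epsilon>))"
      using assms(1) by (intro powr_mono) auto
    also have "\<dots> = \<epsilon> / (3 * (real l)\<^sup>2)"
      using assms(1) l by (simp add: powr_minus)
    finally have "real l * g m \<le> real l * (real l * B * (\<epsilon> / (3 * (real l)\<^sup>2)))"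
      unfolding g_def using B l by (intro mult_left_mono) auto
    also have "\<dots> = \<epsilon> * (B / 3)" using l by (simp add: field_simps power2_eq_square)
    also have "\<dots> \<le> \<epsilon> * opt" using assms(1,5) by (intro mult_left_mono) auto
    also have "\<dots> \<le> (1 + \<epsilon>) * opt" using assms(3) by (simp add: algebra_simps)
    finally show thesis using that[OF guess[of m]] True by simp
  next
    case False
    then obtain r where r: "r \<le> m" "real l * g r < opt" by (auto simp: not_le)
    define r0 where "r0 = (LEAST r. real l * g r < opt)"
    have r0: "real l * g r0 < opt" "r0 \<le> r" unfolding r0_def using r by (auto intro: LeastI Least_le)
    \<comment> \<open>Exponent \<open>0\<close> gives the guess \<open>l * B\<close>, which is not
      too small, so \<open>r0\<close> has a predecessor.\<close>
    have "1 * (real l * B) \<le> real l * (real l * B)" using l B by (intro mult_right_mono) auto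
    then have "opt \<le> real l * g 0" using assms(1,4) by (simp add: g_def)
    then obtain s where s: "r0 = Suc s" using r0(1) by (cases r0) auto
    have "opt \<le> real l * g s" using not_less_Least[of s "\<lambda>r. real l * g r < opt"] s by (simp add: r0_def)
    moreover have "g s = (1 + \<epsilon>) * g r0"
    proof -
      have "(1 + \<epsilon>) powr (- real s) = (1 + \<epsilon>) powr (1 + (- real r0))" by (simp add: s)
      also have "\<dots> = (1 + \<epsilon>) * (1 + \<epsilon>) powr (- real r0)"
        using assms(1) by (subst powr_add) simp
      finally show ?thesis by (simp add: g_def)
    qed
    then have "real l * g s \<le> (1 + \<epsilon>) * opt"
      using r0(1) assms(1) by (simp add: mult.left_commute)
    ultimately show thesis using that[OF guess[of s]] r0(2) r(1) s by simp
  qed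
qed

text \<open>The factor in front depends on \<open>\<epsilon>\<close> only, since
  \<open>max 1 (ln (real l))\<close> absorbs additive terms. Its summand \<open>2\<close> pays for
  rounding up and for the exponent \<open>0\<close>; the absolute value bounds
  \<open>- ln \<epsilon>\<close> by a nonnegative term.\<close>

lemma card_threshold_guesses_le:
  assumes "0 < \<epsilon>" "1 \<le> l"
  shows "real (card (threshold_guesses \<epsilon> l B)) \<le>
    (2 + (ln 3 + \<bar>ln \<epsilon>\<bar> + 2) / ln (1 + \<epsilon>)) * max 1 (ln (real l))"
proof -
  define L where "L = max 1 (ln (real l))"
  have L: "1 \<le> L" "ln (real l) \<le> L" by (auto simp: L_def)
  have pos: "0 < ln (1 + \<epsilon>)" using assms(1) by simp
  define x where "x = log (1 + \<epsilon>) (3 * (real l)\<^sup>2 / \<epsilon>)"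
  define c where "c = (ln 3 + \<bar>ln \<epsilon>\<bar> + 2) / ln (1 + \<epsilon>)"
  have "ln (3 * (real l)\<^sup>2 / \<epsilon>) = ln 3 + 2 * ln (real l) - ln \<epsilon>"
    using assms by (simp add: ln_div ln_mult ln_realpow)
  also have "\<dots> \<le> (ln 3 + \<bar>ln \<epsilon>\<bar>) * 1 + 2 * L" using L by simp
  also have "\<dots> \<le> (ln 3 + \<bar>ln \<epsilon>\<bar>) * L + 2 * L"
    using L by (intro add_right_mono mult_left_mono) auto
  finally have "x \<le> ((ln 3 + \<bar>ln \<epsilon>\<bar>) * L + 2 * L) / ln (1 + \<epsilon>)"
    unfolding x_def log_def using pos by (intro divide_right_mono) auto
  also have "\<dots> = c * L" by (simp add: c_def algebra_simps add_divide_distrib)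
  finally have x: "x \<le> c * L" .
  have "0 \<le> c * L" using pos L by (simp add: c_def)
  have "card (threshold_guesses \<epsilon> l B) \<le> card {..nat \<lceil>x\<rceil>}"
    unfolding threshold_guesses_eq x_def by (rule card_image_le) simp
  then have "real (card (threshold_guesses \<epsilon> l B)) \<le> real (nat \<lceil>x\<rceil>) + 1" by simp
  also have "\<dots> \<le> c * L + 2" using x \<open>0 \<le> c * L\<close> by linarith
  also have "\<dots> \<le> c * L + 2 * L" using L by simp
  finally show ?thesis by (simp add: c_def L_def algebra_simps)
qed

section \<open>Query bound and distortion of the whole mechanism\<close>

context elicitation
begin

lemma ensures_final_query:
  assumes "finite S"
  shows "ensures d C
    (mechanism_bind (query_table (List.product (listing C) (listing S))) (\<lambda>D. Return (alg C S D)))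
    (\<lambda>T. T = alg C S (\<lambda>i a. if i \<in> C \<and> a \<in> S then d i a else 0)) (card S)"
proof (rule ensures_bind[where b = 0, OF ensures_query_table[where b = "card S"]])
  show "length (filter (\<lambda>p. fst p = i) (List.product (listing C) (listing S))) \<le> card S" for i
    using length_filter_product_le[OF listing(1)[OF finite_agents], of i "listing S"]
      listing[OF assms] distinct_card by metis
qed (use listing[OF finite_agents] listing[OF assms] in \<open>auto intro!: ensures_Return\<close>)

lemma Max_set_dist:
  assumes "\<forall>i\<in>C. v i = set_dist d S i"
  shows "\<And>j. j \<in> C \<Longrightarrow> set_dist d S j \<le> Max (v ` C)"
    and "(\<And>j. j \<in> C \<Longrightarrow> set_dist d S j \<le> b) \<Longrightarrow> Max (v ` C) \<le> b"
  using assms finite_agents agents_nonempty by (auto intro: Max_ge_iff[THEN iffD2])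

context
  fixes k l :: nat and \<epsilon> \<delta> \<rho> :: real and alg :: "('c, 'a) centrum_alg"
    and sel :: "'c set \<Rightarrow> 'c" and sel' :: "'a set set \<Rightarrow> 'a set"
  assumes k: "1 \<le> k" and l: "1 \<le> l" "l \<le> card C" and \<epsilon>: "0 < \<epsilon>" and \<delta>: "0 < \<delta>" "\<delta> < 1"
    and approx: "centrum_approximation \<rho> k l alg" and sel: "selector sel" and sel': "selector sel'"
begin

abbreviation "opt \<equiv> OPT k l C A d"

definition "repetitions = nat \<lceil>ln (1 / \<delta>)\<rceil>"

definition "guesses v =
  concat (map (replicate repetitions) (sorted_list_of_set (threshold_guesses \<epsilon> l (Max (v ` C)))))"

definition "cheapest cands = sel' {S. \<exists>c. (S, c) \<in> set cands \<and> (\<forall>(S', c') \<in> set cands. c \<le> c')}"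

definition "finish cands =
  mechanism_bind (query_table (List.product (listing C) (listing (cheapest cands))))
    (\<lambda>D. Return (alg C (cheapest cands) D))"

lemma SampleMech_Gen_eq:
  "SampleMech_Gen sel sel' \<epsilon> \<delta> k l C A \<sigma> alg =
    mechanism_bind (modified_k_center sel k C A \<sigma>) (\<lambda>S0.
    mechanism_bind (query_set_dist C \<sigma> S0) (\<lambda>v.
    mechanism_bind (sample_candidates k l C A \<sigma> (guesses v)) finish))"
  by (simp add: SampleMech_Gen_def Let_def guesses_def repetitions_def finish_def[abs_def] cheapest_def)

definition "admissible cands \<longleftrightarrow> cands \<noteq> [] \<and> (\<forall>(S, c) \<in> set cands.
  S \<subseteq> A \<and> S \<noteq> {} \<and> card S \<le> 77 * k \<and> c = Top l C (set_dist d S))"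

text \<open>A nonempty list has an entry of least cost, so the selector is applied to a nonempty
  set; admissibility makes the recorded costs the true ones.\<close>

lemma cheapest:
  assumes "admissible cands"
  shows "cheapest cands \<subseteq> A" "cheapest cands \<noteq> {}" "card (cheapest cands) \<le> 77 * k"
    and "(S, c) \<in> set cands \<Longrightarrow> Top l C (set_dist d (cheapest cands)) \<le> c"
proof -
  have ne: "set cands \<noteq> {}" using assms by (simp add: admissible_def)
  have "\<exists>p\<in>set cands. snd p = Min (snd ` set cands)"
    using Min_in[of "snd ` set cands"] ne by fastforce
  then obtain S c where S: "(S, c) \<in> set cands" "c = Min (snd ` set cands)" by force
  have "c \<le> snd p" if "p \<in> set cands" for p using S(2) that by simp
  then have "\<forall>(S', c') \<in> set cands. c \<le> c'" by fastforce
  with S(1) have "S \<in> {S. \<exists>c. (S, c) \<in> set cands \<and> (\<forall>(S', c') \<in> set cands. c \<le> c')}" by blast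
  then have "{S. \<exists>c. (S, c) \<in> set cands \<and> (\<forall>(S', c') \<in> set cands. c \<le> c')} \<noteq> {}" by blast
  from sel'[unfolded selector_def, rule_format, OF this]
  obtain c where c: "(cheapest cands, c) \<in> set cands" "\<forall>(S', c') \<in> set cands. c \<le> c'"
    by (auto simp: cheapest_def)
  with assms have *: "cheapest cands \<subseteq> A \<and> cheapest cands \<noteq> {} \<and> card (cheapest cands) \<le> 77 * k \<and>
      c = Top l C (set_dist d (cheapest cands))"
    unfolding admissible_def by fast
  then show "cheapest cands \<subseteq> A" "cheapest cands \<noteq> {}" "card (cheapest cands) \<le> 77 * k" by auto
  show "Top l C (set_dist d (cheapest cands)) \<le> c'" if "(S, c') \<in> set cands" for S c'
    using c(2) that * by auto
qed

lemma ensures_finish: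
  assumes "admissible cands"
  shows "ensures d C (finish cands)
    (\<lambda>T. T = alg C (cheapest cands) (\<lambda>i a. if i \<in> C \<and> a \<in> cheapest cands then d i a else 0)) (77 * k)"
  unfolding finish_def
  by (rule ensures_weaken[OF ensures_final_query])
    (use cheapest[OF assms] finite_centers in auto)

text \<open>As \<open>l\<close> is at least one, no entry of the optimal distance vector exceeds
  \<open>opt\<close>, which therefore serves as the covering radius.\<close>

lemma ensures_k_center_3_approx:
  "ensures d C (modified_k_center sel k C A \<sigma>)
    (\<lambda>S. S \<noteq> {} \<and> S \<subseteq> A \<and> card S \<le> k \<and> (\<forall>j\<in>C. set_dist d S j \<le> 3 * opt)) k"
proof -
  obtain \<kappa> where \<kappa>: "\<kappa> ` C \<subseteq> A" "card (\<kappa> ` C) \<le> k" "Top l C (\<lambda>j. d j (\<kappa> j)) = opt"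
    using OPT_center_map[OF k] by metis
  have "d j (\<kappa> j) \<le> opt" if "j \<in> C" for j
    using le_Top[OF finite_agents l(2,1), of "\<lambda>j. d j (\<kappa> j)" j] dist_nonneg \<kappa> that
    by (simp add: image_subset_iff)
  then show ?thesis by (rule ensures_modified_k_center[OF sel k \<kappa>(1,2)])
qed

text \<open>The logarithm is positive because \<open>\<delta> < 1\<close>. Rounding it up adds at
  most one, hence the factor \<open>2\<close>, and makes the joint failure probability of the
  repetitions at most \<open>\<delta>\<close>.\<close>

lemma repetitions: "1 \<le> repetitions" "real repetitions \<le> 2 * max 1 (ln (1 / \<delta>))"
  "exp (- 1) ^ repetitions \<le> \<delta>"
proof -
  have pos: "0 < ln (1 / \<delta>)" using \<delta> by simp
  then show "1 \<le> repetitions" "real repetitions \<le> 2 * max 1 (ln (1 / \<delta>))"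
    unfolding repetitions_def by linarith+
  have "exp (- 1) ^ repetitions = exp (- real repetitions)" by (simp flip: exp_of_nat_mult)
  also have "\<dots> \<le> exp (- ln (1 / \<delta>))" unfolding repetitions_def exp_le_cancel_iff by linarith
  also have "\<dots> = \<delta>" using \<delta> by (simp add: ln_div)
  finally show "exp (- 1) ^ repetitions \<le> \<delta>" .
qed

lemma threshold_guesses_finite: "finite (threshold_guesses \<epsilon> l B)"
  by (simp add: threshold_guesses_eq)

lemma length_guesses: "length (guesses v) = card (threshold_guesses \<epsilon> l (Max (v ` C))) * repetitions"
proof -
  have "length (concat (map (replicate m) xs)) = length xs * m" for m and xs :: "real list"
    by (induction xs) auto
  then show ?thesis by (simp add: guesses_def)
qed

lemma guesses_nonempty: "guesses v \<noteq> []"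
proof -
  have "threshold_guesses \<epsilon> l B \<noteq> {}" for B by (auto simp: threshold_guesses_eq)
  then have "length (guesses v) \<noteq> 0"
    using repetitions(1) threshold_guesses_finite by (simp add: length_guesses)
  then show ?thesis by simp
qed

lemma ensures_candidates:
  "ensures d C (sample_candidates k l C A \<sigma> (guesses v)) admissible (length (guesses v) * (77 * k + 1))"
  by (rule ensures_weaken[OF ensures_sample_candidates[OF k]])
    (use guesses_nonempty[of v] in \<open>auto simp: admissible_def\<close>)

text \<open>The stages cost \<open>k\<close>, \<open>1\<close>, at most
  \<open>m * (77 * k + 1)\<close> and \<open>77 * k\<close> queries. The fixed part is at most
  \<open>79 * k\<close>; the rest is at most \<open>78 * k\<close> times
  \<open>c * L * (2 * D)\<close>, which explains \<open>156\<close>.\<close>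

lemma ensures_query_bound:
  "ensures d C (SampleMech_Gen sel sel' \<epsilon> \<delta> k l C A \<sigma> alg) (\<lambda>_. True)
    (nat \<lfloor>(79 + 156 * (2 + (ln 3 + \<bar>ln \<epsilon>\<bar> + 2) / ln (1 + \<epsilon>))) * real k * max 1 (ln (real l)) *
       max 1 (ln (1 / \<delta>))\<rfloor>)"
proof -
  define c where "c = 2 + (ln 3 + \<bar>ln \<epsilon>\<bar> + 2) / ln (1 + \<epsilon>)"
  define L where "L = max 1 (ln (real l))"
  define D where "D = max 1 (ln (1 / \<delta>))"
  have LD: "1 \<le> L" "1 \<le> D" by (auto simp: L_def D_def)
  have c: "0 \<le> c" unfolding c_def using \<epsilon> by simp
  define m where "m = nat \<lfloor>c * L * (2 * D)\<rfloor>"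
  have len: "length (guesses v) \<le> m" for v
  proof -
    have "real (length (guesses v)) \<le> (c * L) * (2 * D)"
      using card_threshold_guesses_le[OF \<epsilon> l(1), of "Max (v ` C)"] repetitions(2) c LD
      unfolding length_guesses of_nat_mult
      by (intro mult_mono) (auto simp: c_def L_def D_def)
    then show ?thesis unfolding m_def by linarith
  qed
  have "ensures d C (SampleMech_Gen sel sel' \<epsilon> \<delta> k l C A \<sigma> alg) (\<lambda>_. True)
      (k + (1 + (m * (77 * k + 1) + 77 * k)))"
    unfolding SampleMech_Gen_eq
  proof (rule ensures_bind[OF ensures_k_center_3_approx _ order_refl])
    fix S0 assume S0: "S0 \<noteq> {} \<and> S0 \<subseteq> A \<and> card S0 \<le> k \<and> (\<forall>j\<in>C. set_dist d S0 j \<le> 3 * opt)"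
    show "ensures d C (mechanism_bind (query_set_dist C \<sigma> S0)
        (\<lambda>v. mechanism_bind (sample_candidates k l C A \<sigma> (guesses v)) finish)) (\<lambda>_. True)
      (1 + (m * (77 * k + 1) + 77 * k))"
    proof (rule ensures_bind[OF ensures_query_set_dist _ order_refl])
      show "ensures d C (mechanism_bind (sample_candidates k l C A \<sigma> (guesses v)) finish) (\<lambda>_. True)
        (m * (77 * k + 1) + 77 * k)" for v
      proof (rule ensures_bind[OF ensures_candidates])
        show "ensures d C (finish cands) (\<lambda>_. True) (77 * k)" if "admissible cands" for cands
          by (rule ensures_weaken[OF ensures_finish[OF that]]) auto
        show "length (guesses v) * (77 * k + 1) + 77 * k \<le> m * (77 * k + 1) + 77 * k"
          using len by (intro add_right_mono mult_right_mono) auto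
      qed
    qed (use S0 in auto)
  qed
  moreover have "k + (1 + (m * (77 * k + 1) + 77 * k)) \<le> nat \<lfloor>(79 + 156 * c) * real k * L * D\<rfloor>"
  proof -
    have split: "(79 + 156 * c) * real k * L * D = 79 * real k * (L * D) + c * L * (2 * D) * (78 * real k)"
      by (simp add: algebra_simps)
    have "real m \<le> c * L * (2 * D)" unfolding m_def using c LD by simp
    then have "real m * real (77 * k + 1) \<le> c * L * (2 * D) * (78 * real k)"
      using c LD k by (intro mult_mono) auto
    moreover have "1 * 1 \<le> L * D" using LD by (intro mult_mono) auto
    from mult_left_mono[OF this, of "79 * real k"]
    have "79 * real k \<le> 79 * real k * (L * D)" by simp
    moreover have "real (k + (1 + (m * (77 * k + 1) + 77 * k))) =
        78 * real k + 1 + real m * real (77 * k + 1)" by (simp add: algebra_simps)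
    ultimately have "real (k + (1 + (m * (77 * k + 1) + 77 * k))) \<le> (79 + 156 * c) * real k * L * D"
      using k unfolding split by linarith
    then show ?thesis by linarith
  qed
  ultimately show ?thesis unfolding c_def L_def D_def by (blast intro: ensures_weaken)
qed

text \<open>The constant is \<open>52 + 3 * (1 + \<epsilon>)\<close> for the cost of a successful
  sample, plus \<open>2\<close> for restricting the optimum to it. The absolute value keeps the
  product monotone for any real \<open>\<rho>\<close>.\<close>

definition "good T \<longleftrightarrow> T \<subseteq> A \<and> T \<noteq> {} \<and> card T \<le> k \<and>
  Top l C (set_dist d T) \<le> \<bar>\<rho>\<bar> * (57 + 3 * \<epsilon>) * opt"

lemma good_finish:
  assumes "admissible cands" "(S, c) \<in> set cands" "c \<le> (55 + 3 * \<epsilon>) * opt"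
    and "T \<in> set_pmf (result_pmf d (finish cands))"
  shows "good T"
proof -
  note S = cheapest[OF assms(1)]
  have T: "T = alg C (cheapest cands) (\<lambda>i a. if i \<in> C \<and> a \<in> cheapest cands then d i a else 0)"
    using ensures_result[OF ensures_finish[OF assms(1)] assms(4)] .
  note alg = centrum_approximation_on_candidates[OF approx l(2) S(1,2), folded T]
  have "OPT k l C (cheapest cands) d \<le> 2 * opt + (55 + 3 * \<epsilon>) * opt"
    using OPT_restrict_le[OF k l(2) S(1,2)] S(4)[OF assms(2)] assms(3) by linarith
  also have "\<dots> = (57 + 3 * \<epsilon>) * opt" by (simp add: algebra_simps)
  finally have opt: "OPT k l C (cheapest cands) d \<le> (57 + 3 * \<epsilon>) * opt" .
  have "0 \<le> OPT k l C (cheapest cands) d"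
    using OPT_attained[OF finite_centers[OF S(1)] S(2) k, of l C d] Top_nonneg[OF finite_agents l(2)]
      set_dist_nonneg S(1) by (metis order_trans)
  then have "\<rho> * OPT k l C (cheapest cands) d \<le> \<bar>\<rho>\<bar> * ((57 + 3 * \<epsilon>) * opt)"
    using opt by (intro mult_mono) auto
  then show ?thesis using alg S(1) by (auto simp: good_def)
qed

text \<open>Whatever the first two stages return, some guess is right. A bad output then requires
  every candidate to be too expensive, in particular those of all repetitions of that guess.\<close>

lemma prob_bad_result:
  "measure_pmf.prob (result_pmf d (SampleMech_Gen sel sel' \<epsilon> \<delta> k l C A \<sigma> alg)) {T. \<not> good T} \<le> \<delta>"
  unfolding SampleMech_Gen_eq result_bind
proof (rule prob_bind_pmf_le, rule prob_bind_pmf_le)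
  fix S0 v
  assume S0: "S0 \<in> set_pmf (result_pmf d (modified_k_center sel k C A \<sigma>))"
    and v: "v \<in> set_pmf (result_pmf d (query_set_dist C \<sigma> S0))"
  have center: "S0 \<noteq> {}" "S0 \<subseteq> A" "card S0 \<le> k" "\<And>j. j \<in> C \<Longrightarrow> set_dist d S0 j \<le> 3 * opt"
    using ensures_result[OF ensures_k_center_3_approx S0] by auto
  have v: "\<forall>i\<in>C. v i = set_dist d S0 i"
    using ensures_result[OF ensures_query_set_dist[OF center(2,1)] v] .
  have "0 \<le> opt"
    using OPT_attained[OF finite_alternatives alternatives_nonempty k, of l C d]
      Top_nonneg[OF finite_agents l(2)] set_dist_nonneg by metis
  moreover have "opt \<le> real l * Max (v ` C)"
    using OPT_le[OF finite_alternatives alternatives_nonempty k center(2,1,3), of l C d]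
      Top_le_mult[OF finite_agents l(2), of "set_dist d S0", OF Max_set_dist(1)[OF v]] by linarith
  moreover have "Max (v ` C) \<le> 3 * opt" using center(4) by (intro Max_set_dist(2)[OF v])
  ultimately obtain t where t: "t \<in> threshold_guesses \<epsilon> l (Max (v ` C))" "opt \<le> real l * t"
      "real l * t \<le> (1 + \<epsilon>) * opt"
    using threshold_guess_exists[OF \<epsilon> l(1)] by metis
  let ?b = "3 * real l * t + 52 * opt"
  let ?E = "{cands. \<forall>(S, c) \<in> set cands. ?b < c}"
  let ?cands = "result_pmf d (sample_candidates k l C A \<sigma> (guesses v))"
  have b: "?b \<le> (55 + 3 * \<epsilon>) * opt" using t(3) by (simp add: algebra_simps)
  have "measure_pmf.prob (bind_pmf ?cands (\<lambda>cands. result_pmf d (finish cands))) {T. \<not> good T}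
      \<le> measure_pmf.prob ?cands ?E * 1"
  proof (rule prob_bind_pmf_le_mult)
    fix cands assume cands: "cands \<in> set_pmf ?cands" "cands \<notin> ?E"
    have adm: "admissible cands" using ensures_result[OF ensures_candidates cands(1)] .
    obtain S c where "(S, c) \<in> set cands" "c \<le> ?b" using cands(2) by (auto simp: not_less)
    then have "good T" if "T \<in> set_pmf (result_pmf d (finish cands))" for T
      using good_finish[OF adm _ _ that] b by (meson order_trans)
    then show "measure_pmf.prob (result_pmf d (finish cands)) {T. \<not> good T} = 0"
      by (auto simp: measure_pmf_zero_iff)
  qed simp
  also have "\<dots> \<le> exp (- 1) ^ count_list (guesses v) t"
    using prob_sample_candidates[OF k prob_AD_sample_cost[OF k l t(2)]] by simp
  also have "\<dots> \<le> exp (- 1) ^ repetitions"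
  proof (rule power_decreasing)
    have "count_list (sorted_list_of_set (threshold_guesses \<epsilon> l (Max (v ` C)))) t \<noteq> 0"
      using t(1) threshold_guesses_finite by (simp add: count_list_0_iff)
    then show "repetitions \<le> count_list (guesses v) t"
      by (simp add: guesses_def count_list_concat_replicate)
  qed auto
  also have "\<dots> \<le> \<delta>" by (rule repetitions(3))
  finally show "measure_pmf.prob (bind_pmf ?cands (\<lambda>cands. result_pmf d (finish cands)))
    {T. \<not> good T} \<le> \<delta>" .
qed

lemma SampleMech_Gen_guarantee:
  defines "outcome \<equiv> run d (SampleMech_Gen sel sel' \<epsilon> \<delta> k l C A \<sigma> alg)"
  shows "\<forall>(T, q) \<in> set_pmf outcome. \<forall>i\<in>C. real (q i) \<le>
      (79 + 156 * (2 + (ln 3 + \<bar>ln \<epsilon>\<bar> + 2) / ln (1 + \<epsilon>))) * real k * max 1 (ln (real l)) * max 1 (ln (1 / \<delta>))"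
    and "1 - \<delta> \<le> measure_pmf.prob outcome {(T, q). T \<subseteq> A \<and> T \<noteq> {} \<and> card T \<le> k \<and>
      Top l C (set_dist d T) \<le> \<bar>\<rho>\<bar> * (57 + 3 * \<epsilon>) * OPT k l C A d}"
proof -
  define q0 where "q0 = (79 + 156 * (2 + (ln 3 + \<bar>ln \<epsilon>\<bar> + 2) / ln (1 + \<epsilon>))) * real k *
      max 1 (ln (real l)) * max 1 (ln (1 / \<delta>))"
  have "0 \<le> q0" unfolding q0_def using \<epsilon> by simp
  moreover have "q i \<le> nat \<lfloor>q0\<rfloor>" if "(T, q) \<in> set_pmf outcome" "i \<in> C" for T q i
    using ensures_query_bound that unfolding ensures_def outcome_def q0_def by auto
  ultimately have "real (q i) \<le> q0" if "(T, q) \<in> set_pmf outcome" "i \<in> C" for T q i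
    using that by (meson le_nat_floor of_nat_floor of_nat_le_iff order_trans)
  then show "\<forall>(T, q) \<in> set_pmf outcome. \<forall>i\<in>C. real (q i) \<le>
      (79 + 156 * (2 + (ln 3 + \<bar>ln \<epsilon>\<bar> + 2) / ln (1 + \<epsilon>))) * real k * max 1 (ln (real l)) * max 1 (ln (1 / \<delta>))"
    unfolding q0_def by blast
  have "1 - \<delta> \<le> 1 - measure_pmf.prob (map_pmf fst outcome) {T. \<not> good T}"
    using prob_bad_result by (simp add: outcome_def result_pmf_def)
  also have "\<dots> = measure_pmf.prob (map_pmf fst outcome) (UNIV - {T. \<not> good T})"
    using measure_pmf.prob_compl[of "{T. \<not> good T}" "map_pmf fst outcome"] by simp
  also have "\<dots> = measure_pmf.prob outcome {(T, q). good T}"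
    unfolding measure_map_pmf by (rule arg_cong[where f = "measure_pmf.prob outcome"]) auto
  finally show "1 - \<delta> \<le> measure_pmf.prob outcome {(T, q). T \<subseteq> A \<and> T \<noteq> {} \<and> card T \<le> k \<and>
      Top l C (set_dist d T) \<le> \<bar>\<rho>\<bar> * (57 + 3 * \<epsilon>) * OPT k l C A d}"
    by (simp only: good_def)
qed

end

end

theorem theorem5p5:
  fixes \<epsilon> :: real
  assumes "\<epsilon> > 0"
  shows "\<exists>Q::real. \<forall>\<rho>::real. \<exists>K::real.
    \<forall>(C :: 'c set) (A :: 'a set) d \<sigma> k l \<delta> alg sel sel'.
      finite C \<longrightarrow> finite A \<longrightarrow> A \<noteq> {} \<longrightarrow> 1 \<le> k \<longrightarrow> 1 \<le> l \<longrightarrow> l \<le> card C \<longrightarrow>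
      0 < \<delta> \<longrightarrow> \<delta> < 1 \<longrightarrow>
      distance_fun C A d \<longrightarrow> preference_profile C A \<sigma> \<longrightarrow> consistent C A \<sigma> d \<longrightarrow>
      centrum_approximation \<rho> k l alg \<longrightarrow> selector sel \<longrightarrow> selector sel' \<longrightarrow>
      (let outcome = run d (SampleMech_Gen sel sel' \<epsilon> \<delta> k l C A \<sigma> alg) in
        (\<forall>(T, q) \<in> set_pmf outcome. \<forall>i\<in>C.
           real (q i) \<le> Q * real k * max 1 (ln (real l)) * max 1 (ln (1 / \<delta>))) \<and>
        measure_pmf.prob outcome
          {(T, q). T \<subseteq> A \<and> T \<noteq> {} \<and> card T \<le> k \<and>
             Top l C (set_dist d T) \<le> K * OPT k l C A d} \<ge> 1 - \<delta>)"
\<comment> \<open>The witnesses for \<open>Q\<close> and \<open>K\<close> stay schematic here and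
  are fixed by the \<open>show\<close> below: the first mentions only \<open>\<epsilon>\<close>, the
  second \<open>\<epsilon>\<close> and \<open>\<rho>\<close>.\<close>
proof (intro exI allI exI impI)
  fix \<rho> :: real and C :: "'c set" and A :: "'a set" and d \<sigma> and k l :: nat and \<delta> :: real
    and alg :: "('c, 'a) centrum_alg" and sel :: "'c set \<Rightarrow> 'c" and sel' :: "'a set set \<Rightarrow> 'a set"
  assume asm: "finite C" "finite A" "A \<noteq> {}" "1 \<le> k" "1 \<le> l" "l \<le> card C" "0 < \<delta>" "\<delta> < 1"
    "distance_fun C A d" "preference_profile C A \<sigma>" "consistent C A \<sigma> d"
    "centrum_approximation \<rho> k l alg" "selector sel" "selector sel'"
  \<comment> \<open>Nonemptiness of \<open>C\<close> follows from \<open>1 \<le> l\<close> and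
    \<open>l \<le> card C\<close>.\<close>
  interpret elicitation C A d \<sigma> using asm by unfold_locales auto
  show "let outcome = run d (SampleMech_Gen sel sel' \<epsilon> \<delta> k l C A \<sigma> alg) in
        (\<forall>(T, q) \<in> set_pmf outcome. \<forall>i\<in>C.
           real (q i) \<le> (79 + 156 * (2 + (ln 3 + \<bar>ln \<epsilon>\<bar> + 2) / ln (1 + \<epsilon>))) * real k *
             max 1 (ln (real l)) * max 1 (ln (1 / \<delta>))) \<and>
        measure_pmf.prob outcome
          {(T, q). T \<subseteq> A \<and> T \<noteq> {} \<and> card T \<le> k \<and>
             Top l C (set_dist d T) \<le> (\<bar>\<rho>\<bar> * (57 + 3 * \<epsilon>)) * OPT k l C A d} \<ge> 1 - \<delta>"
    using SampleMech_Gen_guarantee[OF asm(4-6) assms asm(7,8,12-14)] by (simp only: Let_def)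
qed

end
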